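(* Let $0<\theta<1$, let $\lambda_\theta$ be the lens map of parameter $\theta$, and let $w(z)=(1-\lambda_\theta(z))^{a}$ where $a=\frac12\big(1-\frac1\theta\big)<0$. Then $w\in H^2$ and the weighted composition operator $M_wC_{\lambda_\theta}\colon f\mapsto w\,(f\circ\lambda_\theta)$ is bounded but not compact on $H^2$, although $C_{\lambda_\theta}\colon f\mapsto f\circ\lambda_\theta$ belongs to all Schatten classes $S_p(H^2)$, $p>0$.
   Context: $\mathbb{D}$ is the open unit disk and $H^2$ the Hardy space. The lens map of parameter $\theta\in(0,1)$ is $\lambda_\theta(z)=\dfrac{(1+z)^\theta-(1-z)^\theta}{(1+z)^\theta+(1-z)^\theta}$, $z\in\mathbb{D}$ (principal branches of the powers); it is an analytic self-map of $\mathbb{D}$. Since $\operatorname{Re}(1-\lambda_\theta)>0$, the power $(1-\lambda_\theta)^a$ is defined with the principal branch. $S_p(H^2)$, $p>0$, is the Schatten class of compact operators $T$ on $H^2$ with $\sum_n s_n(T)^p<\infty$. *)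

theory Defs
  imports "HOL-Analysis.Analysis"
begin

text \<open>Elements of H^2 are represented by functions complex => complex; only their
values on the open unit disk matter. The n-th Taylor coefficient at 0:\<close>

definition taylor_coeff :: "(complex \<Rightarrow> complex) \<Rightarrow> nat \<Rightarrow> complex" where
  "taylor_coeff f n = (deriv ^^ n) f 0 / of_nat (fact n)"

definition hardy2 :: "(complex \<Rightarrow> complex) set" where
  "hardy2 = {f. f holomorphic_on ball 0 1 \<and>
                summable (\<lambda>n. (cmod (taylor_coeff f n))\<^sup>2)}"

definition hardy_norm :: "(complex \<Rightarrow> complex) \<Rightarrow> real" where
  "hardy_norm f = sqrt (\<Sum>n. (cmod (taylor_coeff f n))\<^sup>2)"

definition hardy_linear_op :: "((complex \<Rightarrow> complex) \<Rightarrow> (complex \<Rightarrow> complex)) \<Rightarrow> bool" where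
  "hardy_linear_op T \<longleftrightarrow>
     (\<forall>f\<in>hardy2. T f \<in> hardy2) \<and>
     (\<forall>f\<in>hardy2. \<forall>g\<in>hardy2. (\<forall>z\<in>ball 0 1. f z = g z) \<longrightarrow>
         (\<forall>z\<in>ball 0 1. T f z = T g z)) \<and>
     (\<forall>f\<in>hardy2. \<forall>g\<in>hardy2. \<forall>z\<in>ball 0 1.
         T (\<lambda>x. f x + g x) z = T f z + T g z) \<and>
     (\<forall>f\<in>hardy2. \<forall>c::complex. \<forall>z\<in>ball 0 1. T (\<lambda>x. c * f x) z = c * T f z)"

definition bounded_hardy_op :: "((complex \<Rightarrow> complex) \<Rightarrow> (complex \<Rightarrow> complex)) \<Rightarrow> bool" where
  "bounded_hardy_op T \<longleftrightarrow> hardy_linear_op T \<and>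
     (\<exists>C. \<forall>f\<in>hardy2. hardy_norm (T f) \<le> C * hardy_norm f)"

definition hardy_op_norm :: "((complex \<Rightarrow> complex) \<Rightarrow> (complex \<Rightarrow> complex)) \<Rightarrow> real" where
  "hardy_op_norm T = Sup {hardy_norm (T f) | f. f \<in> hardy2 \<and> hardy_norm f \<le> 1}"

definition compact_hardy_op :: "((complex \<Rightarrow> complex) \<Rightarrow> (complex \<Rightarrow> complex)) \<Rightarrow> bool" where
  "compact_hardy_op T \<longleftrightarrow> bounded_hardy_op T \<and>
     (\<forall>f::nat \<Rightarrow> complex \<Rightarrow> complex. (\<forall>n. f n \<in> hardy2 \<and> hardy_norm (f n) \<le> 1) \<longrightarrow>
        (\<exists>r g. strict_mono r \<and> g \<in> hardy2 \<and>
           (\<lambda>k. hardy_norm (\<lambda>z. T (f (r k)) z - g z)) \<longlonglongrightarrow> 0))"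

definition rank_less :: "nat \<Rightarrow> ((complex \<Rightarrow> complex) \<Rightarrow> (complex \<Rightarrow> complex)) \<Rightarrow> bool" where
  "rank_less n R \<longleftrightarrow> (\<exists>G. finite G \<and> card G < n \<and> G \<subseteq> hardy2 \<and>
     (\<forall>f\<in>hardy2. \<exists>c. \<forall>z\<in>ball 0 1. R f z = (\<Sum>g\<in>G. c g * g z)))"

text \<open>n-th singular number (n \<ge> 1), as approximation number:
  s_n(T) = inf { ||T - R|| : R bounded, rank R < n }.\<close>

definition singular_number :: "nat \<Rightarrow> ((complex \<Rightarrow> complex) \<Rightarrow> (complex \<Rightarrow> complex)) \<Rightarrow> real" where
  "singular_number n T = Inf {hardy_op_norm (\<lambda>f z. T f z - R f z) | R.
       bounded_hardy_op R \<and> rank_less n R}"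

definition schatten_class :: "real \<Rightarrow> ((complex \<Rightarrow> complex) \<Rightarrow> (complex \<Rightarrow> complex)) \<Rightarrow> bool" where
  "schatten_class p T \<longleftrightarrow> compact_hardy_op T \<and>
     summable (\<lambda>n. singular_number (Suc n) T powr p)"

definition lens_map :: "real \<Rightarrow> complex \<Rightarrow> complex" where
  "lens_map \<theta> z = ((1 + z) powr complex_of_real \<theta> - (1 - z) powr complex_of_real \<theta>) /
                   ((1 + z) powr complex_of_real \<theta> + (1 - z) powr complex_of_real \<theta>)"

end

theory Submission
  imports Defs "HOL-Complex_Analysis.Complex_Analysis" "HOL-Real_Asymp.Real_Asymp"
begin

text \<open>Write \<open>\<lambda> = (S - 1) / (S + 1)\<close> with \<open>S = ((1 + z) / (1 - z))\<^sup>\<theta>\<close>, which takes values in the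
  sector \<open>|arg S| < \<theta>\<pi>/2\<close>. At \<open>z = r e\<^sup>i\<^sup>t\<close> all quantities are controlled, uniformly in \<open>r\<close>, by
  \<open>u = |sin t|\<close>: one has \<open>(u/2)\<^sup>\<theta> \<le> |S| \<le> (2/u)\<^sup>\<theta>\<close>, hence \<open>1 - |\<lambda>| \<ge> c u\<^sup>\<theta>\<close> and \<open>|w|\<^sup>2 \<le> 2 u\<^sup>\<theta>\<^sup>-\<^sup>1\<close>.
  By Bessel's inequality on circles, \<open>H\<^sup>2\<close> norms are bounded by integrals over \<open>t\<close>.

  Boundedness of the weighted operator is a Schur test: Cauchy-Schwarz against the Taylor coefficients of
  \<open>(1 - x)\<^bsup>-1/2\<^esup>\<close> reduces it to \<open>\<integral> u\<^bsup>\<theta>/2-1\<^esup> (1 + n u\<^sup>\<theta>)\<^bsup>-3/2\<^esup> dt = O(n\<^bsup>-1/2\<^esup>)\<close>. It is not compact because the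
  normalised reproducing kernels at \<open>\<lambda>(x)\<close>, \<open>x \<rightarrow> 1\<close>, tend to 0 pointwise while their images do not tend
  to 0 in norm.

  For the singular numbers of the unweighted operator, expand \<open>f = \<Sum> c\<^sub>i E\<^sub>i + B L f\<close>, where \<open>B\<close> is the
  Blaschke product with zeros of multiplicity \<open>m\<close> at the preimages of \<open>S = 2\<^sup>j\<close>, \<open>|j| \<le> m\<close>, and
  \<open>\<parallel>L f\<parallel> \<le> \<parallel>f\<parallel>\<close>. On the image of \<open>\<lambda>\<close> the product \<open>B\<close> is at most \<open>\<rho>\<^sup>m\<close> for \<open>2\<^sup>-\<^sup>m \<le> |S| \<le> 2\<^sup>m\<close>, and the rest
  of the circle is exponentially small in \<open>m\<close>, so \<open>O(m\<^sup>2)\<close> dimensions give an error \<open>O(q\<^sup>m)\<close>.\<close>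

section \<open>Taylor coefficients and point evaluation in the Hardy space\<close>

lemma holomorphic_has_taylor_expansion:
  assumes "f holomorphic_on ball 0 1"
  shows "f has_fps_expansion Abs_fps (taylor_coeff f)"
proof -
  have "f has_fps_expansion fps_expansion f 0"
    using assms by (intro has_fps_expansion_fps_expansion[of "ball 0 1"]) auto
  moreover have "fps_expansion f 0 = Abs_fps (taylor_coeff f)"
    by (simp add: fps_expansion_def taylor_coeff_def fps_eq_iff)
  ultimately show ?thesis by simp
qed

lemma taylor_coeff_unique:
  assumes "f has_fps_expansion F"
  shows "taylor_coeff f n = fps_nth F n"
  using fps_nth_fps_expansion[OF assms] by (simp add: taylor_coeff_def)

lemma taylor_sums:
  assumes "f holomorphic_on ball 0 1" "cmod z < 1"
  shows "(\<lambda>n. taylor_coeff f n * z ^ n) sums f z"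
  using holomorphic_power_series[OF assms(1), of z] assms(2)
  by (simp add: taylor_coeff_def)

lemma taylor_coeff_diff:
  assumes "f holomorphic_on ball 0 1" "g holomorphic_on ball 0 1"
  shows "taylor_coeff (\<lambda>z. f z - g z) n = taylor_coeff f n - taylor_coeff g n"
  using taylor_coeff_unique[OF has_fps_expansion_diff
      [OF holomorphic_has_taylor_expansion[OF assms(1)] holomorphic_has_taylor_expansion[OF assms(2)]]]
  by simp

lemma taylor_coeff_cmult:
  assumes "f holomorphic_on ball 0 1"
  shows "taylor_coeff (\<lambda>z. c * f z) n = c * taylor_coeff f n"
  using taylor_coeff_unique[OF has_fps_expansion_cmult_left
      [OF holomorphic_has_taylor_expansion[OF assms(1)], of c]]
  by simp

lemma hardy2_holomorphic: "f \<in> hardy2 \<Longrightarrow> f holomorphic_on ball 0 1"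
  by (simp add: hardy2_def)

lemma hardy2_summable: "f \<in> hardy2 \<Longrightarrow> summable (\<lambda>n. (cmod (taylor_coeff f n))\<^sup>2)"
  by (simp add: hardy2_def)

lemma hardy_norm_nonneg [simp]: "f \<in> hardy2 \<Longrightarrow> 0 \<le> hardy_norm f"
  by (simp add: hardy_norm_def suminf_nonneg hardy2_summable)

lemma hardy_norm_power2:
  "f \<in> hardy2 \<Longrightarrow> (hardy_norm f)\<^sup>2 = (\<Sum>n. (cmod (taylor_coeff f n))\<^sup>2)"
  by (simp add: hardy_norm_def suminf_nonneg hardy2_summable)

lemma hardy2_diff:
  assumes "f \<in> hardy2" "g \<in> hardy2"
  shows "(\<lambda>z. f z - g z) \<in> hardy2"
    and "(hardy_norm (\<lambda>z. f z - g z))\<^sup>2 \<le> 2 * (hardy_norm f)\<^sup>2 + 2 * (hardy_norm g)\<^sup>2"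
proof -
  let ?a = "taylor_coeff f" and ?b = "taylor_coeff g"
  have hol: "f holomorphic_on ball 0 1" "g holomorphic_on ball 0 1"
    using assms by (auto dest: hardy2_holomorphic)
  have le: "(cmod (?a n - ?b n))\<^sup>2 \<le> 2 * (cmod (?a n))\<^sup>2 + 2 * (cmod (?b n))\<^sup>2" for n
  proof -
    have "(cmod (?a n - ?b n))\<^sup>2 \<le> (cmod (?a n) + cmod (?b n))\<^sup>2"
      by (intro power_mono norm_triangle_ineq4) auto
    also have "\<dots> \<le> 2 * (cmod (?a n))\<^sup>2 + 2 * (cmod (?b n))\<^sup>2"
      using sum_squares_bound[of "cmod (?a n)" "cmod (?b n)"]
      by (simp add: power2_sum)
    finally show ?thesis .
  qed
  have s: "summable (\<lambda>n. 2 * (cmod (?a n))\<^sup>2 + 2 * (cmod (?b n))\<^sup>2)"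
    using assms by (intro summable_add summable_mult hardy2_summable)
  have s': "summable (\<lambda>n. (cmod (?a n - ?b n))\<^sup>2)"
    by (rule summable_comparison_test'[OF s, of 0]) (use le in simp)
  show m: "(\<lambda>z. f z - g z) \<in> hardy2"
    using hol s' by (auto simp: hardy2_def taylor_coeff_diff intro!: holomorphic_intros)
  have "(\<Sum>n. (cmod (?a n - ?b n))\<^sup>2) \<le> (\<Sum>n. 2 * (cmod (?a n))\<^sup>2 + 2 * (cmod (?b n))\<^sup>2)"
    by (intro suminf_le le s s')
  also have "\<dots> = 2 * (\<Sum>n. (cmod (?a n))\<^sup>2) + 2 * (\<Sum>n. (cmod (?b n))\<^sup>2)"
    using assms by (simp add: suminf_add[symmetric] suminf_mult hardy2_summable summable_mult)
  finally show "(hardy_norm (\<lambda>z. f z - g z))\<^sup>2 \<le> 2 * (hardy_norm f)\<^sup>2 + 2 * (hardy_norm g)\<^sup>2"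
    using assms m hol by (simp add: hardy_norm_power2 taylor_coeff_diff)
qed

text \<open>Cauchy-Schwarz against the geometric series, first for Taylor partial sums and then in
  the limit. The factor \<open>1 / (1 - (cmod z)\<^sup>2)\<close> is the squared norm of the
  reproducing kernel at z. Growth estimates for Hardy functions on the disk enter the later
  arguments through this bound.\<close>

lemma hardy2_point_evaluation:
  assumes f: "f \<in> hardy2" and z: "cmod z < 1"
  shows "(cmod (f z))\<^sup>2 \<le> (hardy_norm f)\<^sup>2 / (1 - (cmod z)\<^sup>2)"
proof -
  let ?a = "taylor_coeff f"
  have z2: "(cmod z)\<^sup>2 < 1"
    using z by (simp add: abs_square_less_1)
  have le: "(cmod (\<Sum>n<N. ?a n * z ^ n))\<^sup>2 \<le> (hardy_norm f)\<^sup>2 * (1 / (1 - (cmod z)\<^sup>2))" for N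
  proof -
    have "cmod (\<Sum>n<N. ?a n * z ^ n) \<le> (\<Sum>n<N. cmod (?a n) * cmod z ^ n)"
      by (rule order_trans[OF norm_sum]) (simp add: norm_mult norm_power)
    then have "(cmod (\<Sum>n<N. ?a n * z ^ n))\<^sup>2 \<le> (\<Sum>n<N. cmod (?a n) * cmod z ^ n)\<^sup>2"
      by (intro power_mono) auto
    also have "\<dots> \<le> (\<Sum>n<N. (cmod (?a n))\<^sup>2) * (\<Sum>n<N. (cmod z ^ n)\<^sup>2)"
      by (rule Cauchy_Schwarz_ineq_sum)
    also have "\<dots> \<le> (hardy_norm f)\<^sup>2 * (1 / (1 - (cmod z)\<^sup>2))"
    proof (intro mult_mono sum_nonneg)
      show "(\<Sum>n<N. (cmod (?a n))\<^sup>2) \<le> (hardy_norm f)\<^sup>2"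
        unfolding hardy_norm_power2[OF f]
        by (intro sum_le_suminf hardy2_summable f) auto
      have "(\<Sum>n<N. ((cmod z)\<^sup>2) ^ n) \<le> (\<Sum>n. ((cmod z)\<^sup>2) ^ n)"
        using z2 by (intro sum_le_suminf summable_geometric) auto
      also have "\<dots> = 1 / (1 - (cmod z)\<^sup>2)"
        using z2 by (intro suminf_geometric) auto
      finally show "(\<Sum>n<N. (cmod z ^ n)\<^sup>2) \<le> 1 / (1 - (cmod z)\<^sup>2)"
        by (simp add: power_mult[symmetric] mult.commute)
    qed auto
    finally show ?thesis .
  qed
  have "(\<lambda>N. (cmod (\<Sum>n<N. ?a n * z ^ n))\<^sup>2) \<longlonglongrightarrow> (cmod (f z))\<^sup>2"
    using taylor_sums[OF hardy2_holomorphic[OF f] z]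
    by (intro tendsto_intros) (simp add: sums_def)
  from LIMSEQ_le_const2[OF this] le show ?thesis by auto
qed

lemma geometric_taylor_coeff:
  assumes "cmod p < 1"
  shows "(\<lambda>z. 1 / (1 - p * z)) holomorphic_on ball 0 1"
    and "taylor_coeff (\<lambda>z. 1 / (1 - p * z)) n = p ^ n"
proof -
  have nz: "1 - p * z \<noteq> 0" if "cmod z < 1" for z
  proof
    assume "1 - p * z = 0"
    then have "p * z = 1" by simp
    then have "cmod p * cmod z = 1" by (metis norm_mult norm_one)
    moreover have "cmod p * cmod z < 1"
      using assms that mult_strict_mono'[of "cmod p" 1 "cmod z" 1] by auto
    ultimately show False by simp
  qed
  show hol: "(\<lambda>z. 1 / (1 - p * z)) holomorphic_on ball 0 1"
    using nz by (intro holomorphic_intros) auto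
  have "(\<lambda>z. 1 / (1 - p * z)) has_fps_expansion 1 / (1 - fps_const p * fps_X)"
    by (intro fps_expansion_intros) auto
  moreover have "1 / (1 - fps_const p * fps_X) = Abs_fps (\<lambda>n. p ^ n)"
  proof -
    have "(1 - fps_const p * fps_X) * Abs_fps (\<lambda>n. p ^ n) = 1"
      by (rule fps_ext) (auto simp: left_diff_distrib mult.assoc power_eq_if)
    then show ?thesis
      by (simp add: fps_divide_unit fps_inverse_unique)
  qed
  ultimately show "taylor_coeff (\<lambda>z. 1 / (1 - p * z)) n = p ^ n"
    using taylor_coeff_unique by fastforce
qed

text \<open>This is the kernel reproducing values at the conjugate of p; its norm is a geometric
  series. Normalised kernels are the test functions against compactness.\<close>

lemma szego_kernel_hardy:
  assumes "cmod p < 1"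
  shows "(\<lambda>z. 1 / (1 - p * z)) \<in> hardy2"
    and "(hardy_norm (\<lambda>z. 1 / (1 - p * z)))\<^sup>2 = 1 / (1 - (cmod p)\<^sup>2)"
proof -
  have p2: "(cmod p)\<^sup>2 < 1"
    using assms by (simp add: abs_square_less_1)
  have eq: "(cmod (p ^ n))\<^sup>2 = ((cmod p)\<^sup>2) ^ n" for n
    by (simp add: norm_power power_mult[symmetric] mult.commute)
  show 1: "(\<lambda>z. 1 / (1 - p * z)) \<in> hardy2"
    using geometric_taylor_coeff[OF assms] p2 by (auto simp: hardy2_def eq intro: summable_geometric)
  show "(hardy_norm (\<lambda>z. 1 / (1 - p * z)))\<^sup>2 = 1 / (1 - (cmod p)\<^sup>2)"
    using p2 by (simp add: hardy_norm_power2[OF 1] geometric_taylor_coeff[OF assms] eq suminf_geometric)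
qed

section \<open>Circle means\<close>

text \<open>The period is placed so that it splits into four quarter periods, each with one zero of
  \<open>sin\<close> at an endpoint.\<close>

definition circle_interval :: "real set" where
  "circle_interval = {- pi / 2 .. 3 * pi / 2}"

lemma cis_orthogonal:
  "((\<lambda>t. cis (real n * t) * cnj (cis (real m * t))) has_integral (if n = m then 2 * pi else 0)) circle_interval"
proof (cases "n = m")
  case True
  have "((\<lambda>t. 1 :: complex) has_integral of_real (3 * pi / 2 - - pi / 2)) {- pi / 2 .. 3 * pi / 2}"
    using has_integral_const_real[of "1::complex" "- pi / 2" "3 * pi / 2"]
    by (simp add: scaleR_conv_of_real)
  with True show ?thesis
    by (simp add: circle_interval_def cis_cnj cis_mult)
next
  case False
  define k where "k = real n - real m"
  have k: "k \<noteq> 0" using False by (simp add: k_def)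
  have deriv: "((\<lambda>t. cis (k * t) / (\<i> * k)) has_vector_derivative cis (k * t)) (at t within S)" for t S
  proof -
    have "((\<lambda>t. cis (k * t)) has_derivative (\<lambda>h. (h * k) *\<^sub>R (\<i> * cis (k * t)))) (at t within S)"
      by (rule derivative_eq_intros refl | simp add: mult.commute)+
    then have "((\<lambda>t. cis (k * t)) has_vector_derivative (k *\<^sub>R (\<i> * cis (k * t)))) (at t within S)"
      by (simp add: has_vector_derivative_def)
    from has_vector_derivative_mult_left[OF this, of "1 / (\<i> * k)"] k show ?thesis
      by (simp add: scaleR_conv_of_real)
  qed
  have "((\<lambda>t. cis (k * t)) has_integral
      (cis (k * (3 * pi / 2)) / (\<i> * k) - cis (k * (- pi / 2)) / (\<i> * k))) {- pi / 2 .. 3 * pi / 2}"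
    by (intro fundamental_theorem_of_calculus deriv) simp
  \<comment> \<open>The endpoints differ by 2 pi and k is an integer, so the antiderivative takes
    equal values there and the integral vanishes.\<close>
  moreover have "cis (k * (3 * pi / 2)) = cis (k * (- pi / 2))"
  proof -
    have "k * (3 * pi / 2) = k * (- pi / 2 + 2 * pi)"
      by simp
    also have "\<dots> = k * (- pi / 2) + 2 * pi * of_int (int n - int m)"
      unfolding distrib_left by (simp add: k_def)
    finally show ?thesis
      by (metis cis_mult cis_multiple_2pi Ints_of_int mult.right_neutral)
  qed
  ultimately show ?thesis
    using False by (simp add: circle_interval_def cis_cnj cis_mult k_def algebra_simps)
qed

lemma trig_poly_has_integral:
  fixes c :: "nat \<Rightarrow> complex"
  shows "((\<lambda>t. (cmod (\<Sum>n<N. c n * cis (real n * t)))\<^sup>2) has_integral 2 * pi * (\<Sum>n<N. (cmod (c n))\<^sup>2))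
           circle_interval"
proof -
  have "((\<lambda>t. \<Sum>n<N. \<Sum>m<N. (c n * cnj (c m)) * (cis (real n * t) * cnj (cis (real m * t))))
      has_integral (\<Sum>n<N. \<Sum>m<N. (c n * cnj (c m)) * (if n = m then 2 * pi else 0))) circle_interval"
    by (intro has_integral_sum has_integral_mult_right cis_orthogonal) auto
  also have "(\<lambda>t. \<Sum>n<N. \<Sum>m<N. (c n * cnj (c m)) * (cis (real n * t) * cnj (cis (real m * t)))) =
      (\<lambda>t. of_real ((cmod (\<Sum>n<N. c n * cis (real n * t)))\<^sup>2))"
    unfolding complex_norm_square by (auto simp: sum_product mult_ac intro!: ext sum.cong)
  also have "(\<Sum>n<N. \<Sum>m<N. (c n * cnj (c m)) * (if n = m then 2 * pi else 0)) =
      of_real (2 * pi * (\<Sum>n<N. (cmod (c n))\<^sup>2))"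
  proof -
    have "(\<Sum>n<N. \<Sum>m<N. (c n * cnj (c m)) * (if n = m then 2 * pi else 0)) =
        (\<Sum>n<N. (c n * cnj (c n)) * of_real (2 * pi))"
      by (simp add: if_distrib[of of_real] if_distrib[of "(*) _"] sum.delta cong: if_cong)
    also have "\<dots> = of_real (2 * pi * (\<Sum>n<N. (cmod (c n))\<^sup>2))"
      unfolding complex_norm_square[symmetric] of_real_mult of_real_sum sum_distrib_left
      by (simp add: mult_ac)
    finally show ?thesis .
  qed
  finally show ?thesis
    by (auto dest!: has_integral_Re)
qed

lemma norm_rcis_lt_1: "0 < r \<Longrightarrow> r < 1 \<Longrightarrow> cmod (of_real r * cis t) < 1"
  by (simp add: norm_mult)

text \<open>Parseval holds for every Taylor section on the circle of radius r. The sections are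
  dominated by the convergent sum of \<open>cmod (c n)\<close>, so their integrals tend to the mean
  of f. The \<open>ennreal\<close> integral lets later majorants be inserted without integrability
  side conditions.\<close>

lemma hardy_bessel:
  assumes hol: "f holomorphic_on ball 0 1" and r: "0 < r" "r < 1"
  shows "ennreal (2 * pi * (\<Sum>n<N. (cmod (taylor_coeff f n))\<^sup>2 * r ^ (2 * n)))
    \<le> (\<integral>\<^sup>+ t. indicator circle_interval t * ennreal ((cmod (f (of_real r * cis t)))\<^sup>2) \<partial>lborel)"
proof -
  define c where "c n = taylor_coeff f n * of_real r ^ n" for n
  define P where "P M t = (\<Sum>n<M. c n * cis (real n * t))" for M t
  have cn: "(cmod (c n))\<^sup>2 = (cmod (taylor_coeff f n))\<^sup>2 * r ^ (2 * n)" for n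
    using r by (simp add: c_def norm_mult norm_power power_mult_distrib power_mult[symmetric] mult.commute)
  have summ: "summable (\<lambda>n. cmod (c n))"
  proof -
    \<comment> \<open>Convergence of the power series at a larger radius gives absolute convergence
      at r.\<close>
    obtain r' where r': "r < r'" "r' < 1"
      using r(2) dense by blast
    have "summable (\<lambda>n. taylor_coeff f n * of_real r' ^ n)"
      using taylor_sums[OF hol, of "of_real r'"] r r' by (auto simp: sums_iff)
    then show ?thesis
      unfolding c_def by (rule powser_insidea) (use r r' in auto)
  qed
  have lim: "(\<lambda>M. P M t) \<longlonglongrightarrow> f (of_real r * cis t)" for t
    using taylor_sums[OF hol norm_rcis_lt_1[OF r], of t]
    unfolding P_def c_def sums_def by (simp add: power_mult_distrib Complex.DeMoivre mult_ac)
  have bd: "(cmod (P M t))\<^sup>2 \<le> (\<Sum>n. cmod (c n))\<^sup>2" for M t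
  proof (rule power_mono)
    have "cmod (P M t) \<le> (\<Sum>n<M. cmod (c n))"
      unfolding P_def by (rule order_trans[OF norm_sum]) (simp add: norm_mult)
    also have "\<dots> \<le> (\<Sum>n. cmod (c n))"
      by (intro sum_le_suminf summ) auto
    finally show "cmod (P M t) \<le> (\<Sum>n. cmod (c n))" .
  qed auto
  have hi: "((\<lambda>t. (cmod (P M t))\<^sup>2) has_integral 2 * pi * (\<Sum>n<M. (cmod (c n))\<^sup>2)) circle_interval" for M
    unfolding P_def by (rule trig_poly_has_integral)
  let ?g = "\<lambda>t. (cmod (f (of_real r * cis t)))\<^sup>2"
  have h: "(\<lambda>_. (\<Sum>n. cmod (c n))\<^sup>2) integrable_on circle_interval"
    unfolding circle_interval_def by (rule integrable_const_ivl)
  have fi: "(\<lambda>t. (cmod (P k t))\<^sup>2) integrable_on circle_interval" for k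
    using hi by blast
  have fb: "norm ((cmod (P k x))\<^sup>2) \<le> (\<Sum>n. cmod (c n))\<^sup>2" for k x
    using bd by simp
  have "(\<lambda>k. (cmod (P k x))\<^sup>2) \<longlonglongrightarrow> ?g x" for x
    by (intro tendsto_intros lim)
  note dc = dominated_convergence[OF fi h fb this]
  have "2 * pi * (\<Sum>n<N. (cmod (c n))\<^sup>2) \<le> integral circle_interval ?g"
  proof (rule LIMSEQ_le_const[OF dc(2)], intro exI[of _ N] allI impI)
    fix M assume "M \<ge> N"
    then have "(\<Sum>n<N. (cmod (c n))\<^sup>2) \<le> (\<Sum>n<M. (cmod (c n))\<^sup>2)"
      by (intro sum_mono2) auto
    then show "2 * pi * (\<Sum>n<N. (cmod (c n))\<^sup>2) \<le> integral circle_interval (\<lambda>t. (cmod (P M t))\<^sup>2)"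
      using integral_unique[OF hi] by simp
  qed
  moreover have "(\<integral>\<^sup>+ t. indicator circle_interval t * ennreal (?g t) \<partial>lborel) = ennreal (integral circle_interval ?g)"
    using nn_integral_has_integral_lebesgue[of circle_interval ?g, OF _ integrable_integral[OF dc(1)]]
    by (simp add: ennreal_mult' ennreal_indicator[symmetric])
  ultimately show ?thesis
    unfolding cn by (simp add: ennreal_leI)
qed

text \<open>For fixed N the left side of \<open>hardy_bessel\<close> is a polynomial in r, so r may
  tend to 1 before N grows.\<close>

lemma hardy2_if_circle_means_bounded:
  assumes hol: "f holomorphic_on ball 0 1" and M: "0 \<le> M"
  assumes le: "\<And>r. 0 < r \<Longrightarrow> r < 1 \<Longrightarrow>
    (\<integral>\<^sup>+ t. indicator circle_interval t * ennreal ((cmod (f (of_real r * cis t)))\<^sup>2) \<partial>lborel) \<le> ennreal M"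
  shows "f \<in> hardy2" and "(hardy_norm f)\<^sup>2 \<le> M"
proof -
  let ?a = "\<lambda>n. (cmod (taylor_coeff f n))\<^sup>2"
  have part: "(\<Sum>n<N. ?a n) \<le> M" for N
  proof -
    have "2 * pi * (\<Sum>n<N. ?a n * r ^ (2 * n)) \<le> M" if "0 < r" "r < 1" for r
      using order_trans[OF hardy_bessel[OF hol that, of N] le[OF that]] M by simp
    then have ev: "eventually (\<lambda>r. 2 * pi * (\<Sum>n<N. ?a n * r ^ (2 * n)) \<le> M) (at_left 1)"
      by (intro eventually_at_leftI[of 0]) auto
    have "((\<lambda>r. 2 * pi * (\<Sum>n<N. ?a n * r ^ (2 * n))) \<longlongrightarrow> 2 * pi * (\<Sum>n<N. ?a n * 1 ^ (2 * n))) (at_left (1::real))"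
      by (intro tendsto_intros)
    from tendsto_upperbound[OF this ev] have "2 * pi * (\<Sum>n<N. ?a n) \<le> M"
      by simp
    \<comment> \<open>Since 2 pi is at least 1, the normalising factor is simply dropped.\<close>
    moreover have "(\<Sum>n<N. ?a n) \<le> 2 * pi * (\<Sum>n<N. ?a n)"
      using mult_right_mono[of 1 "2 * pi" "\<Sum>n<N. ?a n"] pi_ge_two by (simp add: sum_nonneg)
    ultimately show ?thesis by linarith
  qed
  have s: "summable ?a"
    by (rule summableI_nonneg_bounded[OF _ part]) auto
  show "f \<in> hardy2"
    using s hol by (simp add: hardy2_def)
  then show "(hardy_norm f)\<^sup>2 \<le> M"
    using suminf_le_const[OF s part] by (simp add: hardy_norm_power2)
qed

section \<open>Integrals of singular weights in \<open>\<bar>sin t\<bar>\<close> over the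
  circle\<close>

definition singular_weight :: "real \<Rightarrow> nat \<Rightarrow> real \<Rightarrow> real" where
  "singular_weight \<beta> n u = u powr (\<beta> / 2 - 1) * (1 + real n * u powr \<beta>) powr (- 3 / 2)"

lemma singular_weight_nonneg [simp]: "0 \<le> singular_weight \<beta> n u"
  by (simp add: singular_weight_def)

lemma singular_weight_measurable [measurable]: "singular_weight \<beta> n \<in> borel_measurable borel"
  unfolding singular_weight_def by measurable

lemma singular_weight_antimono:
  assumes "0 < \<beta>" "\<beta> < 2" "0 < u" "u \<le> v"
  shows "singular_weight \<beta> n v \<le> singular_weight \<beta> n u"
  unfolding singular_weight_def
  using assms by (intro mult_mono powr_mono2' add_mono mult_left_mono powr_mono2 add_pos_nonneg) auto

text \<open>Up to pi/3 the difference is nondecreasing, because cos is at least 1/2 there. Beyond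
  that, sin is at least sqrt 3 / 2, which exceeds 4/5 and hence pi/4.\<close>

lemma sin_ge_half:
  assumes "0 \<le> x" "x \<le> pi / 2"
  shows "x / 2 \<le> sin x"
proof (cases "x \<le> pi / 3")
  case True
  have "(\<lambda>x. sin x - x / 2) 0 \<le> (\<lambda>x. sin x - x / 2) x"
  proof (rule DERIV_nonneg_imp_nondecreasing[OF assms(1)])
    fix y assume y: "0 \<le> y" "y \<le> x"
    have "((\<lambda>x. sin x - x / 2) has_real_derivative cos y - 1 / 2) (at y)"
      by (auto intro!: derivative_eq_intros)
    moreover have "cos (pi / 3) \<le> cos y"
      using y True by (intro cos_monotone_0_pi_le) auto
    ultimately show "\<exists>d. ((\<lambda>x. sin x - x / 2) has_real_derivative d) (at y) \<and> 0 \<le> d"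
      by (auto simp: cos_60)
  qed
  then show ?thesis by simp
next
  case False
  have "sin (pi / 3) \<le> sin x"
    using False assms by (intro sin_monotone_2pi_le) auto
  moreover have "x / 2 \<le> 4 / 5"
    using assms pi_less_4 pi_approx by simp
  moreover have "8 / 5 \<le> sqrt 3"
    by (rule real_le_rsqrt) (simp add: power2_eq_square)
  ultimately show ?thesis by (simp add: sin_60)
qed

text \<open>The exponents of the weight are such that it has an elementary antiderivative. The
  weight serves twice: with \<beta> = \<theta> it is the kernel of the Schur test, and with n = 0 it
  is a pure power. The argument s/2 appears because \<open>sin_ge_half\<close> replaces the sine by
  it.\<close>

lemma singular_weight_half_integral:
  assumes \<beta>: "0 < \<beta>"
  shows "(\<integral>\<^sup>+ s. indicator {0..pi/2} s * ennreal (singular_weight \<beta> n (s / 2)) \<partial>lborel)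
     \<le> ennreal (4 / \<beta> / sqrt (1 + real n))"
proof -
  \<comment> \<open>With v = s/2, the derivative of \<open>v powr (\<beta> / 2) * (1 + n * v powr
    \<beta>) powr (- 1 / 2)\<close> in v is \<beta>/2 times the weight; the substitution contributes
    another factor 2, which gives 4/\<beta>.\<close>
  define G where "G s = 4 / \<beta> * ((s / 2) powr (\<beta> / 2) * (1 + real n * (s / 2) powr \<beta>) powr (- 1 / 2))" for s :: real
  have pos: "1 + real n * (s / 2) powr \<beta> > 0" for s
    by (simp add: add_pos_nonneg)
  \<comment> \<open>\<open>G\<close> need not be differentiable at 0, so the fundamental theorem is
    used with continuity on the closed interval and derivatives in the interior only.\<close>
  have "((\<lambda>s. singular_weight \<beta> n (s / 2)) has_integral (G (pi / 2) - G 0)) {0..pi/2}"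
  proof (rule fundamental_theorem_of_calculus_interior)
    show "continuous_on {0..pi/2} G"
      unfolding G_def using \<beta> pos
      by (intro continuous_intros continuous_on_powr') (auto simp: less_imp_neq[symmetric] less_imp_le)
    fix s :: real assume s: "s \<in> {0<..<pi/2}"
    define v where "v = s / 2"
    define q where "q = 1 + real n * v powr \<beta>"
    have q: "q > 0" using pos[of s] by (simp add: q_def v_def)
    have v: "v > 0" using s by (simp add: v_def)
    have "(G has_real_derivative
        4 / \<beta> * ((\<beta> / 4) * v powr (\<beta> / 2 - 1) * q powr (- 1 / 2)
          + v powr (\<beta> / 2) * ((- 1 / 2) * q powr (- 1 / 2 - 1) * (real n * (\<beta> * v powr (\<beta> - 1) / 2))))) (at s)"
      unfolding G_def q_def v_def using \<beta> pos[of s] s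
      by (auto intro!: derivative_eq_intros simp: field_simps)
    also have "4 / \<beta> * ((\<beta> / 4) * v powr (\<beta> / 2 - 1) * q powr (- 1 / 2)
          + v powr (\<beta> / 2) * ((- 1 / 2) * q powr (- 1 / 2 - 1) * (real n * (\<beta> * v powr (\<beta> - 1) / 2))))
        = v powr (\<beta> / 2 - 1) * q powr (- 3 / 2)"
    proof -
      have 1: "q powr (- 1 / 2) = q * q powr (- 3 / 2)"
        using powr_add[of q 1 "- 3 / 2"] q by simp
      have 2: "v powr (\<beta> / 2) * v powr (\<beta> - 1) = v powr (\<beta> / 2 - 1) * v powr \<beta>"
        by (simp add: powr_add[symmetric])
      have "4 / \<beta> * ((\<beta> / 4) * v powr (\<beta> / 2 - 1) * q powr (- 1 / 2)
          + v powr (\<beta> / 2) * ((- 1 / 2) * q powr (- 1 / 2 - 1) * (real n * (\<beta> * v powr (\<beta> - 1) / 2))))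
        = v powr (\<beta> / 2 - 1) * (q * q powr (- 3 / 2))
          - (v powr (\<beta> / 2) * v powr (\<beta> - 1)) * q powr (- 3 / 2) * real n"
        using \<beta> 1 by (simp add: field_simps)
      also have "\<dots> = v powr (\<beta> / 2 - 1) * q powr (- 3 / 2) * (q - real n * v powr \<beta>)"
        unfolding 2 by (simp add: algebra_simps)
      finally show ?thesis by (simp add: q_def)
    qed
    finally show "(G has_vector_derivative singular_weight \<beta> n (s / 2)) (at s)"
      by (simp add: has_real_derivative_iff_has_vector_derivative singular_weight_def q_def v_def)
  qed simp
  then have "(\<integral>\<^sup>+ s. ennreal (indicator {0..pi/2} s * singular_weight \<beta> n (s / 2)) \<partial>lborel)
      = ennreal (G (pi / 2) - G 0)"
    by (intro nn_integral_has_integral_lebesgue) auto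
  moreover have "G (pi / 2) - G 0 \<le> 4 / \<beta> / sqrt (1 + real n)"
  proof -
    define x where "x = (pi / 4) powr \<beta>"
    have x: "0 < x" "x \<le> 1"
      using \<beta> pi_less_4 by (auto simp: x_def intro!: powr_le1)
    have e: "(pi / 4) powr (\<beta> / 2) = sqrt x"
      by (simp add: x_def powr_half_sqrt[symmetric] powr_powr)
    have "(1 + real n * x) powr (- 1 / 2) = 1 / sqrt (1 + real n * x)"
      using x powr_minus_divide[of "1 + real n * x" "1 / 2"] by (simp add: powr_half_sqrt)
    then have "G (pi / 2) - G 0 = 4 / \<beta> * sqrt (x / (1 + real n * x))"
      using e \<beta> by (simp add: G_def x_def real_sqrt_divide)
    \<comment> \<open>The quotient increases with x, and x is at most 1 because pi/4 < 1.\<close>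
    also have "x / (1 + real n * x) \<le> 1 / (1 + real n)"
      using x by (simp add: divide_simps add_pos_nonneg) (simp add: algebra_simps)
    then have "4 / \<beta> * sqrt (x / (1 + real n * x)) \<le> 4 / \<beta> * sqrt (1 / (1 + real n))"
      using \<beta> by (intro mult_left_mono real_sqrt_le_mono) auto
    finally show ?thesis by (simp add: real_sqrt_divide)
  qed
  ultimately show ?thesis
    by (simp add: ennreal_mult' ennreal_indicator[symmetric] ennreal_leI)
qed

text \<open>Each quarter period is carried to \<open>{0..pi/2}\<close> by a translation or
  reflection under which \<open>\<bar>sin t\<bar>\<close> becomes sin s. Monotonicity of the weight
  and \<open>sin_ge_half\<close> then reduce to the previous integral, four times.\<close>

lemma singular_weight_circle_integral:
  assumes \<beta>: "0 < \<beta>" "\<beta> < 2"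
  shows "(\<integral>\<^sup>+ t. indicator circle_interval t * ennreal (singular_weight \<beta> n \<bar>sin t\<bar>) \<partial>lborel)
     \<le> ennreal (16 / \<beta> / sqrt (1 + real n))"
proof -
  define h where "h s = indicator {0..pi/2} s * ennreal (singular_weight \<beta> n (s / 2))" for s :: real
  have [measurable]: "h \<in> borel_measurable borel"
    unfolding h_def by measurable
  have near: "ennreal (singular_weight \<beta> n \<bar>sin t\<bar>) \<le> h s" if "\<bar>sin t\<bar> = sin s" "s \<in> {0..pi/2}" for t s
  proof (cases "s = 0")
    \<comment> \<open>At the singular point the weight is 0, since
      \<open>0 powr x = 0\<close>.\<close>
    case True
    with that show ?thesis by (simp add: singular_weight_def)
  next
    case False
    then have "singular_weight \<beta> n \<bar>sin t\<bar> \<le> singular_weight \<beta> n (s / 2)"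
      using that \<beta> sin_ge_half[of s] by (intro singular_weight_antimono) auto
    then show ?thesis
      using that by (simp add: h_def ennreal_leI)
  qed
  have incr: "x \<le> a \<or> x \<le> b \<or> x \<le> c \<or> x \<le> d \<Longrightarrow> x \<le> a + b + c + d" for x a b c d :: ennreal
    by (meson add_increasing add_increasing2 zero_le)
  \<comment> \<open>At each point of the circle one of the four terms dominates. The arguments are
    written as affine maps to match the substitution rule
    \<open>nn_integral_real_affine\<close>.\<close>
  have "indicator circle_interval t * ennreal (singular_weight \<beta> n \<bar>sin t\<bar>)
      \<le> h (0 + 1 * t) + h (0 + (-1) * t) + h (- pi + 1 * t) + h (pi + (-1) * t)" for t
  proof (cases "t \<in> circle_interval")
    case True
    then consider "- pi / 2 \<le> t" "t \<le> 0" | "0 \<le> t" "t \<le> pi / 2" | "pi / 2 \<le> t" "t \<le> pi"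
      | "pi \<le> t" "t \<le> 3 * pi / 2"
      unfolding circle_interval_def by fastforce
    then show ?thesis
    proof cases
      case 1
      then have "\<bar>sin t\<bar> = sin (- t)" using sin_ge_zero[of "-t"] by auto
      from near[OF this] 1 show ?thesis
        using True incr by simp
    next
      case 2
      then have "\<bar>sin t\<bar> = sin t" using sin_ge_zero[of t] by auto
      from near[OF this] 2 show ?thesis
        using True incr by simp
    next
      case 3
      then have "\<bar>sin t\<bar> = sin (pi - t)" using sin_ge_zero[of t] by auto
      from near[OF this] 3 show ?thesis
        using True incr by simp
    next
      case 4
      then have "\<bar>sin t\<bar> = sin (t - pi)" using sin_ge_zero[of "t - pi"] by (auto simp: sin_diff)
      from near[OF this] 4 show ?thesis
        using True incr by simp
    qed
  qed simp
  then have "(\<integral>\<^sup>+ t. indicator circle_interval t * ennreal (singular_weight \<beta> n \<bar>sin t\<bar>) \<partial>lborel)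
     \<le> (\<integral>\<^sup>+ t. h (0 + 1 * t) + h (0 + (-1) * t) + h (- pi + 1 * t) + h (pi + (-1) * t) \<partial>lborel)"
    by (intro nn_integral_mono)
  also have "\<dots> = (\<integral>\<^sup>+ t. h (0 + 1 * t) \<partial>lborel) + (\<integral>\<^sup>+ t. h (0 + (-1) * t) \<partial>lborel)
     + (\<integral>\<^sup>+ t. h (- pi + 1 * t) \<partial>lborel) + (\<integral>\<^sup>+ t. h (pi + (-1) * t) \<partial>lborel)"
    by (simp add: nn_integral_add)
  also have "\<dots> = (\<integral>\<^sup>+ t. h t \<partial>lborel) + (\<integral>\<^sup>+ t. h t \<partial>lborel) + (\<integral>\<^sup>+ t. h t \<partial>lborel) + (\<integral>\<^sup>+ t. h t \<partial>lborel)"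
    using nn_integral_real_affine[of h 1 0] nn_integral_real_affine[of h "-1" 0]
      nn_integral_real_affine[of h 1 "- pi"] nn_integral_real_affine[of h "-1" pi] by simp
  also have "\<dots> \<le> ennreal (4 / \<beta> / sqrt (1 + real n)) + ennreal (4 / \<beta> / sqrt (1 + real n))
     + ennreal (4 / \<beta> / sqrt (1 + real n)) + ennreal (4 / \<beta> / sqrt (1 + real n))"
    unfolding h_def by (intro add_mono singular_weight_half_integral \<beta>)
  also have "\<dots> = ennreal (16 / \<beta> / sqrt (1 + real n))"
    using \<beta> by (simp add: ennreal_plus[symmetric] del: ennreal_plus)
  finally show ?thesis .
qed

text \<open>Allows every pointwise estimate on circles to assume
  \<open>sin t \<noteq> 0\<close>.\<close>

lemma AE_sin_nonzero: "AE t in lborel. sin t \<noteq> (0::real)"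
proof -
  have "{t::real. sin t = 0} = (\<lambda>i. of_int i * pi) ` UNIV"
    by (auto simp: sin_zero_iff_int2)
  then have "countable {t::real. sin t = 0}" by simp
  then have "AE t in lborel. t \<notin> {t::real. sin t = 0}"
    by (intro AE_not_in countable_imp_null_set_lborel)
  then show ?thesis by simp
qed

text \<open>The power \<open>\<bar>sin t\<bar> powr (- \<kappa>)\<close> is integrable for \<kappa>
  < 1, so a majorant uniform in r bounds all circle means. Membership and smallness in norm for the
  unweighted operator are obtained through this criterion.\<close>

lemma hardy2_if_sin_majorant:
  assumes \<kappa>: "0 < \<kappa>" "\<kappa> < 1" and A: "0 \<le> A"
    and hol: "f holomorphic_on ball 0 1"
    and le: "\<And>r t. 0 < r \<Longrightarrow> r < 1 \<Longrightarrow> sin t \<noteq> 0 \<Longrightarrow>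
       (cmod (f (of_real r * cis t)))\<^sup>2 \<le> A * \<bar>sin t\<bar> powr (- \<kappa>)"
  shows "f \<in> hardy2" and "(hardy_norm f)\<^sup>2 \<le> 8 / (1 - \<kappa>) * A"
proof -
  \<comment> \<open>Chosen so that \<open>\<beta> / 2 - 1 = - \<kappa>\<close>; the weight with n =
    0 is then the majorant itself.\<close>
  define \<beta> where "\<beta> = 2 * (1 - \<kappa>)"
  have \<beta>: "0 < \<beta>" "\<beta> < 2" using \<kappa> by (auto simp: \<beta>_def)
  have M: "0 \<le> 8 / (1 - \<kappa>) * A" using \<kappa> A by simp
  have sw: "singular_weight \<beta> 0 u = u powr (- \<kappa>)" for u
  proof -
    have "\<beta> / 2 - 1 = - \<kappa>" by (simp add: \<beta>_def field_simps)
    then show ?thesis by (simp add: singular_weight_def)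
  qed
  have "(\<integral>\<^sup>+ t. indicator circle_interval t * ennreal ((cmod (f (of_real r * cis t)))\<^sup>2) \<partial>lborel)
      \<le> ennreal (8 / (1 - \<kappa>) * A)" if r: "0 < r" "r < 1" for r
  proof -
    have "(\<integral>\<^sup>+ t. indicator circle_interval t * ennreal ((cmod (f (of_real r * cis t)))\<^sup>2) \<partial>lborel)
       \<le> (\<integral>\<^sup>+ t. ennreal A * (indicator circle_interval t * ennreal (singular_weight \<beta> 0 \<bar>sin t\<bar>)) \<partial>lborel)"
    proof (rule nn_integral_mono_AE, use AE_sin_nonzero in eventually_elim)
      fix t :: real assume "sin t \<noteq> 0"
      from le[OF r this] have "ennreal ((cmod (f (of_real r * cis t)))\<^sup>2) \<le> ennreal A * ennreal (singular_weight \<beta> 0 \<bar>sin t\<bar>)"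
        using A by (simp add: sw ennreal_mult[symmetric] ennreal_leI)
      then show "indicator circle_interval t * ennreal ((cmod (f (of_real r * cis t)))\<^sup>2)
        \<le> ennreal A * (indicator circle_interval t * ennreal (singular_weight \<beta> 0 \<bar>sin t\<bar>))"
        by (auto simp: indicator_def)
    qed
    also have "\<dots> = ennreal A * (\<integral>\<^sup>+ t. indicator circle_interval t * ennreal (singular_weight \<beta> 0 \<bar>sin t\<bar>) \<partial>lborel)"
      by (rule nn_integral_cmult) (simp add: circle_interval_def)
    also have "\<dots> \<le> ennreal A * ennreal (16 / \<beta> / sqrt (1 + real 0))"
      by (intro mult_left_mono singular_weight_circle_integral \<beta>) auto
    also have "\<dots> = ennreal (8 / (1 - \<kappa>) * A)"
    proof -
      have "16 / \<beta> = 8 / (1 - \<kappa>)"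
        using \<kappa> by (simp add: \<beta>_def field_simps)
      then show ?thesis
        using A \<kappa> by (simp add: ennreal_mult[symmetric] mult.commute)
    qed
    finally show ?thesis .
  qed
  from hardy2_if_circle_means_bounded[OF hol M this]
  show "f \<in> hardy2" "(hardy_norm f)\<^sup>2 \<le> 8 / (1 - \<kappa>) * A" by auto
qed

section \<open>The lens map\<close>

definition lens_power :: "real \<Rightarrow> complex \<Rightarrow> complex" where
  "lens_power \<theta> z = ((1 + z) / (1 - z)) powr of_real \<theta>"

lemma cayley_Re_pos:
  assumes "cmod z < 1"
  shows "0 < Re ((1 + z) / (1 - z))"
proof -
  have "z \<noteq> 1" using assms by auto
  then have "0 < (cmod (1 - z))\<^sup>2" by simp
  moreover have "Re ((1 + z) / (1 - z)) = (1 - (cmod z)\<^sup>2) / (cmod (1 - z))\<^sup>2"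
    by (simp add: Re_divide cmod_power2) (simp add: algebra_simps power2_eq_square)
  moreover have "(cmod z)\<^sup>2 < 1" using assms by (simp add: abs_square_less_1)
  ultimately show ?thesis by simp
qed

context
  fixes \<theta> :: real
  assumes \<theta>: "0 < \<theta>" "\<theta> < 1"
begin

text \<open>The logarithm of the Cayley transform has imaginary part below pi/2 in modulus, and the
  power multiplies it by \<theta>. The claim about the cosine alone does not depend on z; later uses
  instantiate z = 0.\<close>

lemma lens_power_sector:
  assumes "cmod z < 1"
  shows "cos (\<theta> * pi / 2) * cmod (lens_power \<theta> z) \<le> Re (lens_power \<theta> z)"
    and "0 < cmod (lens_power \<theta> z)"
    and "0 < cos (\<theta> * pi / 2)"
    and "0 < Re (lens_power \<theta> z)"
proof -
  let ?\<sigma> = "(1 + z) / (1 - z)"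
  have nz: "?\<sigma> \<noteq> 0" using cayley_Re_pos[OF assms] by auto
  have S: "lens_power \<theta> z = exp (of_real \<theta> * Ln ?\<sigma>)"
    using nz by (simp add: lens_power_def powr_def)
  have im: "\<bar>Im (Ln ?\<sigma>)\<bar> < pi / 2"
    using nz cayley_Re_pos[OF assms] Re_Ln_pos_lt by blast
  show c0: "0 < cos (\<theta> * pi / 2)"
    using \<theta> by (intro cos_gt_zero_pi) (auto intro: order.strict_trans1[of _ 0])
  have "cos (\<theta> * pi / 2) \<le> cos \<bar>\<theta> * Im (Ln ?\<sigma>)\<bar>"
  proof (rule cos_monotone_0_pi_le)
    show "\<bar>\<theta> * Im (Ln ?\<sigma>)\<bar> \<le> \<theta> * pi / 2"
      using im \<theta> mult_left_mono[of "\<bar>Im (Ln ?\<sigma>)\<bar>" "pi / 2" \<theta>] by (simp add: abs_mult)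
    show "\<theta> * pi / 2 \<le> pi" using \<theta> mult_right_mono[of \<theta> 2 pi] by simp
  qed simp
  also have "cos \<bar>\<theta> * Im (Ln ?\<sigma>)\<bar> = cos (\<theta> * Im (Ln ?\<sigma>))"
    by (simp add: abs_if)
  finally show "cos (\<theta> * pi / 2) * cmod (lens_power \<theta> z) \<le> Re (lens_power \<theta> z)"
    by (simp add: S Re_exp mult.commute)
  moreover show "0 < cmod (lens_power \<theta> z)" by (simp add: S)
  ultimately show "0 < Re (lens_power \<theta> z)"
    using c0 by (meson mult_pos_pos order_less_le_trans)
qed

lemma lens_power_plus_1_nonzero:
  assumes "cmod z < 1"
  shows "lens_power \<theta> z + 1 \<noteq> 0"
proof
  assume "lens_power \<theta> z + 1 = 0"
  then have "Re (lens_power \<theta> z) + 1 = 0" by (metis plus_complex.sel(1) one_complex.sel(1) zero_complex.sel(1))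
  with lens_power_sector(4)[OF assms] show False by linarith
qed

text \<open>The definition uses two separate powers. The logarithms of the Cayley transform and of 1
  - z both have imaginary part below pi/2, so they add without a branch jump and
  \<open>(1 - z) powr \<theta>\<close> cancels from the fraction.\<close>

lemma lens_map_eq:
  assumes "cmod z < 1"
  shows "lens_map \<theta> z = (lens_power \<theta> z - 1) / (lens_power \<theta> z + 1)"
proof -
  let ?\<sigma> = "(1 + z) / (1 - z)"
  have z1: "1 - z \<noteq> 0" using assms by auto
  have nz: "?\<sigma> \<noteq> 0" using cayley_Re_pos[OF assms] by auto
  have re: "0 < Re (1 - z)" using assms complex_Re_le_cmod[of z] by simp
  have "\<bar>Im (Ln ?\<sigma>)\<bar> < pi / 2"
    using nz cayley_Re_pos[OF assms] Re_Ln_pos_lt by blast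
  moreover have "\<bar>Im (Ln (1 - z))\<bar> < pi / 2"
    using z1 re Re_Ln_pos_lt by blast
  ultimately have "Ln (?\<sigma> * (1 - z)) = Ln ?\<sigma> + Ln (1 - z)"
    using nz z1 by (intro Ln_times_simple) auto
  moreover have "?\<sigma> * (1 - z) = 1 + z" using z1 by simp
  ultimately have ln: "Ln (1 + z) = Ln ?\<sigma> + Ln (1 - z)" by simp
  define B where "B = (1 - z) powr of_real \<theta>"
  define S where "S = lens_power \<theta> z"
  have "1 + z \<noteq> 0" using nz by auto
  then have A: "(1 + z) powr of_real \<theta> = S * B"
    using nz z1 ln by (simp add: S_def B_def lens_power_def powr_def exp_add[symmetric] distrib_left)
  have B: "B \<noteq> 0" using z1 by (simp add: B_def)
  have "lens_map \<theta> z = (S * B - B) / (S * B + B)"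
    by (simp add: lens_map_def A B_def)
  also have "\<dots> = ((S - 1) * B) / ((S + 1) * B)"
    by (simp add: algebra_simps)
  finally show ?thesis using B by (simp add: S_def)
qed

lemma one_minus_lens_map:
  assumes "cmod z < 1"
  shows "1 - lens_map \<theta> z = 2 / (lens_power \<theta> z + 1)"
  using lens_power_plus_1_nonzero[OF assms] by (simp add: lens_map_eq[OF assms] field_simps)

text \<open>Rests on the identity |S + 1|^2 - |S - 1|^2 = 4 Re S.\<close>

lemma one_minus_norm_lens_map:
  assumes "cmod z < 1"
  shows "1 - (cmod (lens_map \<theta> z))\<^sup>2 = 4 * Re (lens_power \<theta> z) / (cmod (lens_power \<theta> z + 1))\<^sup>2"
proof -
  let ?S = "lens_power \<theta> z"
  have "0 < (cmod (?S + 1))\<^sup>2"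
    using lens_power_plus_1_nonzero[OF assms] by simp
  moreover have "4 * Re ?S = (cmod (?S + 1))\<^sup>2 - (cmod (?S - 1))\<^sup>2"
    unfolding cmod_power2 by (simp add: power2_eq_square algebra_simps)
  moreover have "(cmod (lens_map \<theta> z))\<^sup>2 = (cmod (?S - 1))\<^sup>2 / (cmod (?S + 1))\<^sup>2"
    by (simp add: lens_map_eq[OF assms] norm_divide power_divide)
  ultimately show ?thesis
    by (simp add: diff_divide_distrib)
qed

lemma lens_map_in_disk:
  assumes "cmod z < 1"
  shows "cmod (lens_map \<theta> z) < 1"
proof -
  have "0 < 1 - (cmod (lens_map \<theta> z))\<^sup>2"
    unfolding one_minus_norm_lens_map[OF assms]
    using lens_power_sector(4)[OF assms] lens_power_plus_1_nonzero[OF assms] by simp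
  then show ?thesis by (simp add: abs_square_less_1)
qed

lemma lens_map_holomorphic: "lens_map \<theta> holomorphic_on ball 0 1"
proof -
  have "z \<in> ball 0 1 \<Longrightarrow> (1 + z) / (1 - z) \<notin> \<real>\<^sub>\<le>\<^sub>0" for z :: complex
    using cayley_Re_pos[of z] by (auto simp: complex_nonpos_Reals_iff)
  moreover have "z \<in> ball 0 1 \<Longrightarrow> 1 - z \<noteq> 0" for z :: complex by auto
  ultimately have "(\<lambda>z. lens_power \<theta> z) holomorphic_on ball 0 1"
    unfolding lens_power_def by (intro holomorphic_intros) auto
  then have "(\<lambda>z. (lens_power \<theta> z - 1) / (lens_power \<theta> z + 1)) holomorphic_on ball 0 1"
    using lens_power_plus_1_nonzero by (intro holomorphic_intros) auto
  then show ?thesis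
    by (rule holomorphic_transform) (simp add: lens_map_eq)
qed

lemma comp_lens_map_holomorphic:
  assumes "f holomorphic_on ball 0 1"
  shows "(\<lambda>z. f (lens_map \<theta> z)) holomorphic_on ball 0 1"
proof -
  have "lens_map \<theta> ` ball 0 1 \<subseteq> ball 0 1"
    using lens_map_in_disk by auto
  from holomorphic_on_compose_gen[OF lens_map_holomorphic assms this] show ?thesis
    by (simp add: o_def)
qed

text \<open>The squared distance from r cis t to 1 or -1 is \<open>(sin t)\<^sup>2\<close> plus a
  square, whatever r is; this is the source of the uniformity in r.\<close>

lemma abs_sin_le_norm:
  "\<bar>sin t\<bar> \<le> cmod (1 - of_real r * cis t)" "\<bar>sin t\<bar> \<le> cmod (1 + of_real r * cis t)"
proof -
  have "(sin t)\<^sup>2 \<le> (sin t)\<^sup>2 + (cos t - r)\<^sup>2" by simp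
  also have "\<dots> = (cmod (1 - of_real r * cis t))\<^sup>2"
    unfolding cmod_power2
    using sin_cos_squared_add[of t] by (simp add: power2_eq_square) algebra
  finally show "\<bar>sin t\<bar> \<le> cmod (1 - of_real r * cis t)"
    by (metis abs_le_square_iff abs_norm_cancel)
next
  have "(sin t)\<^sup>2 \<le> (sin t)\<^sup>2 + (cos t + r)\<^sup>2" by simp
  also have "\<dots> = (cmod (1 + of_real r * cis t))\<^sup>2"
    unfolding cmod_power2
    using sin_cos_squared_add[of t] by (simp add: power2_eq_square) algebra
  finally show "\<bar>sin t\<bar> \<le> cmod (1 + of_real r * cis t)"
    by (metis abs_le_square_iff abs_norm_cancel)
qed

text \<open>Both |1 + z| and |1 - z| lie between \<open>\<bar>sin t\<bar>\<close> and 2, which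
  bounds their quotient from both sides.\<close>

lemma lens_power_polar_bounds:
  assumes r: "0 < r" "r < 1" and t: "sin t \<noteq> 0"
  shows "(\<bar>sin t\<bar> / 2) powr \<theta> \<le> cmod (lens_power \<theta> (of_real r * cis t))"
    and "cmod (lens_power \<theta> (of_real r * cis t)) \<le> (2 / \<bar>sin t\<bar>) powr \<theta>"
proof -
  let ?z = "of_real r * cis t"
  have z: "cmod ?z < 1" by (rule norm_rcis_lt_1[OF r])
  have eq: "cmod (lens_power \<theta> ?z) = (cmod (1 + ?z) / cmod (1 - ?z)) powr \<theta>"
    by (simp add: lens_power_def norm_powr_real_powr' norm_divide)
  have u: "0 < \<bar>sin t\<bar>" using t by simp
  have up: "cmod (1 + ?z) \<le> 2" "cmod (1 - ?z) \<le> 2"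
    using norm_triangle_ineq[of 1 ?z] norm_triangle_ineq4[of 1 ?z] z by auto
  note lo = abs_sin_le_norm[of t r]
  have "\<bar>sin t\<bar> / 2 \<le> cmod (1 + ?z) / cmod (1 - ?z)"
    using up lo u by (intro frac_le) auto
  then show "(\<bar>sin t\<bar> / 2) powr \<theta> \<le> cmod (lens_power \<theta> ?z)"
    unfolding eq using \<theta> by (intro powr_mono2) auto
  have "cmod (1 + ?z) / cmod (1 - ?z) \<le> 2 / \<bar>sin t\<bar>"
    using up lo u by (intro frac_le) auto
  then show "cmod (lens_power \<theta> ?z) \<le> (2 / \<bar>sin t\<bar>) powr \<theta>"
    unfolding eq using \<theta> by (intro powr_mono2) auto
qed

text \<open>By the sector estimate the exact formula is at least cos(\<theta> pi/2) times 4s/(1+s)^2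
  with s = |S|. This expression is invariant under s -> 1/s, as is the two-sided bound on s, so
  small and large s give the same estimate.\<close>

lemma one_minus_norm_lens_map_polar:
  assumes r: "0 < r" "r < 1" and t: "sin t \<noteq> 0"
  shows "cos (\<theta> * pi / 2) * (\<bar>sin t\<bar> / 2) powr \<theta> \<le> 1 - (cmod (lens_map \<theta> (of_real r * cis t)))\<^sup>2"
proof -
  let ?z = "of_real r * cis t"
  have z: "cmod ?z < 1" by (rule norm_rcis_lt_1[OF r])
  define s where "s = cmod (lens_power \<theta> ?z)"
  have s: "0 < s" "0 < cos (\<theta> * pi / 2)" using lens_power_sector[OF z] by (auto simp: s_def)
  define x where "x = (\<bar>sin t\<bar> / 2) powr \<theta>"
  have x: "0 < x" using t by (simp add: x_def)
  have "(2 / \<bar>sin t\<bar>) powr \<theta> = 1 / x"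
    using t by (simp add: x_def powr_divide)
  with lens_power_polar_bounds[OF assms] have xs: "x \<le> s" "s \<le> 1 / x"
    by (auto simp: x_def s_def)
  \<comment> \<open>The right side is at least min(s, 1/s), and both s and 1/s are at least
    x.\<close>
  have "x \<le> 4 * s / (1 + s)\<^sup>2"
  proof (cases "s \<le> 1")
    case True
    have "(1 + s)\<^sup>2 \<le> 2\<^sup>2" using True s by (intro power_mono) auto
    then have "s * (1 + s)\<^sup>2 \<le> s * 4" using s by (intro mult_left_mono) auto
    then have "s \<le> 4 * s / (1 + s)\<^sup>2" using s by (simp add: pos_le_divide_eq mult.commute)
    with xs show ?thesis by linarith
  next
    case False
    have "(1 + s)\<^sup>2 \<le> (2 * s)\<^sup>2" using False by (intro power_mono) auto
    then have "1 / s * (1 + s)\<^sup>2 \<le> 1 / s * (2 * s)\<^sup>2" using s by (intro mult_left_mono) auto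
    also have "\<dots> = 4 * s" using s by (simp add: power2_eq_square)
    finally have "1 / s \<le> 4 * s / (1 + s)\<^sup>2" using s by (subst pos_le_divide_eq) auto
    moreover have "x \<le> 1 / s" using xs s x by (simp add: field_simps)
    ultimately show ?thesis by linarith
  qed
  then have "cos (\<theta> * pi / 2) * x \<le> cos (\<theta> * pi / 2) * (4 * s / (1 + s)\<^sup>2)"
    using s by (intro mult_left_mono) auto
  also have "\<dots> = 4 * (cos (\<theta> * pi / 2) * s) / (1 + s)\<^sup>2" by simp
  also have "\<dots> \<le> 4 * Re (lens_power \<theta> ?z) / (cmod (lens_power \<theta> ?z + 1))\<^sup>2"
  proof (intro frac_le power_mono)
    show "cmod (lens_power \<theta> ?z + 1) \<le> 1 + s"
      using norm_triangle_ineq[of "lens_power \<theta> ?z" 1] by (simp add: s_def)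
    show "4 * (cos (\<theta> * pi / 2) * s) \<le> 4 * Re (lens_power \<theta> ?z)"
      using lens_power_sector(1)[OF z] by (simp add: s_def)
    show "0 \<le> 4 * Re (lens_power \<theta> ?z)"
      using lens_power_sector(4)[OF z] by simp
    show "0 < (cmod (lens_power \<theta> ?z + 1))\<^sup>2"
      using lens_power_plus_1_nonzero[OF z] by simp
  qed auto
  finally show ?thesis
    by (simp add: one_minus_norm_lens_map[OF z] x_def)
qed

text \<open>Since 1 - \<lambda> = 2/(S+1), the squared modulus of the weight is (|S+1|/2)^b with b =
  1/\<theta> - 1. Here |S+1|/2 is at most \<open>(2 / \<bar>sin t\<bar>) powr \<theta>\<close>, and
  the exponents multiply to 1 - \<theta>; the factor 2 absorbs 2^(1-\<theta>).\<close>

lemma lens_weight_polar_bound: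
  assumes r: "0 < r" "r < 1" and t: "sin t \<noteq> 0"
  shows "(cmod ((1 - lens_map \<theta> (of_real r * cis t)) powr of_real ((1 - 1 / \<theta>) / 2)))\<^sup>2
     \<le> 2 * \<bar>sin t\<bar> powr (\<theta> - 1)"
proof -
  let ?z = "of_real r * cis t"
  have z: "cmod ?z < 1" by (rule norm_rcis_lt_1[OF r])
  define s where "s = cmod (lens_power \<theta> ?z + 1)"
  define b where "b = 1 / \<theta> - 1"
  have b: "0 < b" using \<theta> by (simp add: b_def)
  have s: "0 < s" using lens_power_plus_1_nonzero[OF z] by (simp add: s_def)
  have u: "0 < \<bar>sin t\<bar>" "\<bar>sin t\<bar> \<le> 1" using t by auto
  have "s \<le> cmod (lens_power \<theta> ?z) + 1"
    using norm_triangle_ineq[of "lens_power \<theta> ?z" 1] by (simp add: s_def)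
  also have "\<dots> \<le> (2 / \<bar>sin t\<bar>) powr \<theta> + (2 / \<bar>sin t\<bar>) powr \<theta>"
  proof (intro add_mono lens_power_polar_bounds(2)[OF assms] ge_one_powr_ge_zero)
    have "\<bar>sin t\<bar> \<le> 2" using u by linarith
    then show "1 \<le> 2 / \<bar>sin t\<bar>" using u(1) by (simp only: pos_le_divide_eq mult_1_left)
  qed (use \<theta> in simp)
  finally have s2: "s / 2 \<le> (2 / \<bar>sin t\<bar>) powr \<theta>" by simp
  have "(cmod ((1 - lens_map \<theta> ?z) powr of_real ((1 - 1 / \<theta>) / 2)))\<^sup>2 = ((2 / s) powr ((1 - 1 / \<theta>) / 2))\<^sup>2"
    by (subst norm_powr_real_powr') (auto simp: one_minus_lens_map[OF z] norm_divide s_def)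
  also have "\<dots> = (2 / s) powr (- b)"
    using s by (simp add: b_def power2_eq_square powr_add[symmetric])
  also have "\<dots> = (s / 2) powr b"
    using s by (simp add: powr_minus_divide powr_divide)
  also have "\<dots> \<le> ((2 / \<bar>sin t\<bar>) powr \<theta>) powr b"
    using s2 s b by (intro powr_mono2) auto
  also have "\<dots> = (2 / \<bar>sin t\<bar>) powr (1 - \<theta>)"
    using \<theta> by (simp add: powr_powr b_def right_diff_distrib)
  also have "\<dots> = 2 powr (1 - \<theta>) * \<bar>sin t\<bar> powr (\<theta> - 1)"
    using u by (simp add: powr_divide powr_minus_divide[of _ "1 - \<theta>", simplified])
  also have "\<dots> \<le> 2 * \<bar>sin t\<bar> powr (\<theta> - 1)"
    using powr_mono[of "1 - \<theta>" 1 "2::real"] \<theta> by (intro mult_right_mono) auto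
  finally show ?thesis .
qed

lemma lens_weight_holomorphic:
  "(\<lambda>z. (1 - lens_map \<theta> z) powr of_real c) holomorphic_on ball 0 1"
proof -
  have "1 - lens_map \<theta> z \<notin> \<real>\<^sub>\<le>\<^sub>0" if "z \<in> ball 0 1" for z
    using lens_map_in_disk[of z] complex_Re_le_cmod[of "lens_map \<theta> z"] that
    by (auto simp: complex_nonpos_Reals_iff)
  then show ?thesis
    by (intro holomorphic_intros lens_map_holomorphic) auto
qed

text \<open>Only the growth of f is assumed, so that the bound also applies to functions not known
  to be in the Hardy space, such as locally uniform limits.\<close>

lemma comp_lens_map_polar_bound:
  assumes r: "0 < r" "r < 1" and t: "sin t \<noteq> 0"
    and f: "\<And>z. cmod z < 1 \<Longrightarrow> (cmod (f z))\<^sup>2 \<le> A / (1 - (cmod z)\<^sup>2)" and A: "0 \<le> A"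
  shows "(cmod (f (lens_map \<theta> (of_real r * cis t))))\<^sup>2
      \<le> A * 2 / cos (\<theta> * pi / 2) * \<bar>sin t\<bar> powr (- \<theta>)"
proof -
  let ?l = "lens_map \<theta> (of_real r * cis t)"
  define c where "c = cos (\<theta> * pi / 2)"
  have c: "0 < c" using lens_power_sector(3)[of 0] by (simp add: c_def)
  have pos: "0 < c * (\<bar>sin t\<bar> / 2) powr \<theta>" using c t by simp
  have "(cmod (f ?l))\<^sup>2 \<le> A / (1 - (cmod ?l)\<^sup>2)"
    by (intro f lens_map_in_disk norm_rcis_lt_1 r)
  also have "\<dots> \<le> A / (c * (\<bar>sin t\<bar> / 2) powr \<theta>)"
    using one_minus_norm_lens_map_polar[OF r t] A pos
    by (intro divide_left_mono mult_pos_pos[OF _ pos]) (auto simp: c_def)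
  also have "\<dots> = A * 2 powr \<theta> / c * \<bar>sin t\<bar> powr (- \<theta>)"
    by (simp add: powr_divide powr_minus_divide)
  also have "\<dots> \<le> A * 2 / c * \<bar>sin t\<bar> powr (- \<theta>)"
    using powr_mono[of \<theta> 1 "2::real"] \<theta> A c
    by (intro mult_right_mono divide_right_mono mult_left_mono) auto
  finally show ?thesis by (simp add: c_def)
qed

end

section \<open>The weighted composition operator\<close>

definition inv_sqrt_coeff :: "nat \<Rightarrow> real" where
  "inv_sqrt_coeff n = (-1) ^ n * ((- 1 / 2) gchoose n)"

lemma inv_sqrt_coeff_Suc:
  "inv_sqrt_coeff (Suc n) = inv_sqrt_coeff n * ((2 * real n + 1) / (2 * real n + 2))"
  by (simp add: inv_sqrt_coeff_def gbinomial_prod_rev field_simps)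

text \<open>The sequence (4n+1) c_n^2 starts at 1 and is nondecreasing, by the ratio recursion;
  hence 1/c_n is at most the square root of 4n+1.\<close>

lemma inv_sqrt_coeff_bounds:
  "0 < inv_sqrt_coeff n" "1 / inv_sqrt_coeff n \<le> 2 * sqrt (1 + real n)"
proof -
  show pos: "0 < inv_sqrt_coeff n" for n
    by (induction n) (auto simp: inv_sqrt_coeff_Suc, simp add: inv_sqrt_coeff_def)
  have "1 \<le> (4 * real n + 1) * (inv_sqrt_coeff n)\<^sup>2"
  proof (induction n)
    case 0
    show ?case by (simp add: inv_sqrt_coeff_def)
  next
    case (Suc n)
    have "(4 * real n + 1) \<le> (4 * real (Suc n) + 1) * ((2 * real n + 1) / (2 * real n + 2))\<^sup>2"
      by (simp add: power_divide pos_le_divide_eq) (simp add: power2_eq_square algebra_simps)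
    from mult_right_mono[OF this, of "(inv_sqrt_coeff n)\<^sup>2"]
    have "(4 * real n + 1) * (inv_sqrt_coeff n)\<^sup>2 \<le> (4 * real (Suc n) + 1) * (inv_sqrt_coeff (Suc n))\<^sup>2"
      unfolding inv_sqrt_coeff_Suc power_mult_distrib by (simp only: mult_ac zero_le_power2)
    with Suc show ?case by linarith
  qed
  then have "(1 / inv_sqrt_coeff n)\<^sup>2 \<le> 4 * real n + 1"
    using pos[of n] by (simp add: power_divide divide_le_eq)
  also have "\<dots> \<le> (2 * sqrt (1 + real n))\<^sup>2"
    by (simp add: power_mult_distrib)
  finally show "1 / inv_sqrt_coeff n \<le> 2 * sqrt (1 + real n)"
    by (rule power2_le_imp_le) simp
qed

lemma inv_sqrt_coeff_sums:
  assumes "0 \<le> x" "x < 1"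
  shows "(\<lambda>n. inv_sqrt_coeff n * x ^ n) sums (1 - x) powr (- 1 / 2)"
proof -
  have "(\<lambda>n. ((- 1 / 2) gchoose n) * (- x) ^ n) sums (1 + - x) powr (- 1 / 2)"
    using assms by (intro gen_binomial_real) auto
  moreover have "(- x) ^ n = (-1) ^ n * x ^ n" for n
    by (rule power_minus)
  ultimately show ?thesis
    by (simp add: inv_sqrt_coeff_def mult_ac)
qed

text \<open>Exponential decay is traded for the power -3/2 that occurs in
  \<open>singular_weight\<close>, by way of exp(-y) <= 2 (1+y)^(-2) from the quadratic Taylor
  bound.\<close>

lemma power_le_powr_three_halves:
  assumes x: "0 \<le> x" "x \<le> 1 - c * v" and c: "0 < c" "c \<le> 1" and v: "0 \<le> v"
  shows "x ^ n \<le> 2 * c powr (- 3 / 2) * (1 + real n * v) powr (- 3 / 2)"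
proof -
  define y where "y = real n * (c * v)"
  have y: "0 \<le> y" using c v by (simp add: y_def)
  have "x \<le> exp (- (c * v))"
    using x exp_ge_add_one_self[of "- (c * v)"] by linarith
  then have "x ^ n \<le> exp (- (c * v)) ^ n"
    using x by (intro power_mono) auto
  also have "\<dots> = exp (- y)"
    by (simp add: y_def exp_of_nat_mult[symmetric])
  also have "\<dots> \<le> 2 * (1 + y) powr (- 2)"
  proof -
    have "1 + y + y\<^sup>2 / 2 \<le> exp y" using exp_lower_Taylor_quadratic[OF y] .
    then have "(1 + y)\<^sup>2 \<le> 2 * exp y" by (simp add: power2_eq_square algebra_simps)
    moreover have "0 < (1 + y)\<^sup>2" using y by simp
    ultimately have "1 / exp y \<le> 2 * (1 / (1 + y)\<^sup>2)" by (simp add: field_simps)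
    moreover have "(1 + y) powr (- 2) = 1 / (1 + y)\<^sup>2"
      using y by (simp add: powr_minus_divide)
    ultimately show ?thesis
      by (simp add: exp_minus inverse_eq_divide)
  qed
  also have "\<dots> \<le> 2 * (1 + y) powr (- 3 / 2)"
    using y by (intro mult_left_mono powr_mono) auto
  \<comment> \<open>As c is at most 1, c(1 + nv) is at most 1 + ncv, and the exponent is
    negative.\<close>
  also have "\<dots> \<le> 2 * (c * (1 + real n * v)) powr (- 3 / 2)"
    using c v y by (intro mult_left_mono powr_mono2' mult_pos_pos add_pos_nonneg)
      (auto simp: y_def algebra_simps)
  also have "\<dots> = 2 * c powr (- 3 / 2) * (1 + real n * v) powr (- 3 / 2)"
    using c v by (simp add: powr_mult)
  finally show ?thesis .
qed

context
  fixes \<theta> :: real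
  assumes \<theta>: "0 < \<theta>" "\<theta> < 1"
begin

lemma norm_lens_map_polar:
  assumes r: "0 < r" "r < 1" and t: "sin t \<noteq> 0"
  shows "cmod (lens_map \<theta> (of_real r * cis t)) \<le> 1 - cos (\<theta> * pi / 2) / 4 * \<bar>sin t\<bar> powr \<theta>"
proof -
  define x where "x = cmod (lens_map \<theta> (of_real r * cis t))"
  define c where "c = cos (\<theta> * pi / 2)"
  have c: "0 < c" using lens_power_sector(3)[OF \<theta>, of 0] by (simp add: c_def)
  have x: "0 \<le> x" "x < 1"
    using lens_map_in_disk[OF \<theta> norm_rcis_lt_1[OF r]] by (auto simp: x_def)
  have "c * (\<bar>sin t\<bar> powr \<theta> / 2) \<le> c * (\<bar>sin t\<bar> / 2) powr \<theta>"
  proof (intro mult_left_mono)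
    have "\<bar>sin t\<bar> powr \<theta> / 2 \<le> \<bar>sin t\<bar> powr \<theta> / 2 powr \<theta>"
      using powr_mono[of \<theta> 1 "2::real"] \<theta> by (intro divide_left_mono) auto
    then show "\<bar>sin t\<bar> powr \<theta> / 2 \<le> (\<bar>sin t\<bar> / 2) powr \<theta>"
      by (simp add: powr_divide)
  qed (use c in simp)
  also have "\<dots> \<le> 1 - x\<^sup>2"
    using one_minus_norm_lens_map_polar[OF \<theta> r t] by (simp add: x_def c_def)
  also have "\<dots> = (1 - x) * (1 + x)" by (simp add: power2_eq_square algebra_simps)
  also have "\<dots> \<le> (1 - x) * 2" using x by (intro mult_left_mono) auto
  finally show ?thesis by (simp add: x_def c_def)
qed

text \<open>This is the pointwise half of the Schur test. The bound for the weight contributes the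
  exponent \<theta> - 1 and the auxiliary series contributes -\<theta>/2, adding up to the
  \<theta>/2 - 1 of \<open>singular_weight\<close>. The constant 8 collects a factor 2 each from the
  weight, from 1/c_n and from the exponential bound.\<close>

lemma weighted_partial_sum_bound:
  assumes r: "0 < r" "r < 1" and t: "sin t \<noteq> 0"
  defines "z \<equiv> of_real r * cis t"
  shows "(cmod ((1 - lens_map \<theta> z) powr of_real ((1 - 1 / \<theta>) / 2) * (\<Sum>n<N. a n * lens_map \<theta> z ^ n)))\<^sup>2
    \<le> (\<Sum>n<N. 8 * (cos (\<theta> * pi / 2) / 4) powr (- 2) * (cmod (a n))\<^sup>2 * sqrt (1 + real n)
          * singular_weight \<theta> n \<bar>sin t\<bar>)"
proof -
  define x where "x = cmod (lens_map \<theta> z)"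
  define c where "c = cos (\<theta> * pi / 2) / 4"
  define u where "u = \<bar>sin t\<bar>"
  define v where "v = u powr \<theta>"
  have c: "0 < c" "c \<le> 1"
    using lens_power_sector(3)[OF \<theta>, of 0] cos_le_one[of "\<theta> * pi / 2"] unfolding c_def
    by (simp, linarith)
  have u: "0 < u" using t by (simp add: u_def)
  have v: "0 < v" using u by (simp add: v_def)
  have x: "0 \<le> x" "x < 1" "x \<le> 1 - c * v"
    using lens_map_in_disk[OF \<theta> norm_rcis_lt_1[OF r, of t]] norm_lens_map_polar[OF r t]
    by (auto simp: x_def z_def c_def v_def u_def)
  have "cmod (\<Sum>n<N. a n * lens_map \<theta> z ^ n) \<le> (\<Sum>n<N. cmod (a n) * x ^ n)"
    by (rule order_trans[OF norm_sum]) (simp add: norm_mult norm_power x_def)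
  then have "(cmod (\<Sum>n<N. a n * lens_map \<theta> z ^ n))\<^sup>2 \<le> (\<Sum>n<N. cmod (a n) * x ^ n)\<^sup>2"
    by (intro power_mono) auto
  \<comment> \<open>The split for Cauchy-Schwarz: the second factors square to the Taylor series of
    (1-x)^(-1/2), whose sum is known, and the first keep the weights 1/c_n of order at most the
    square root of n.\<close>
  also have "(\<Sum>n<N. cmod (a n) * x ^ n) =
      (\<Sum>n<N. (cmod (a n) * sqrt (x ^ n / inv_sqrt_coeff n)) * sqrt (inv_sqrt_coeff n * x ^ n))"
  proof (rule sum.cong)
    fix n
    have "sqrt (x ^ n / inv_sqrt_coeff n) * sqrt (inv_sqrt_coeff n * x ^ n) = sqrt (x ^ n * x ^ n)"
      using inv_sqrt_coeff_bounds(1)[of n] by (subst real_sqrt_mult[symmetric]) simp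
    then show "cmod (a n) * x ^ n =
        (cmod (a n) * sqrt (x ^ n / inv_sqrt_coeff n)) * sqrt (inv_sqrt_coeff n * x ^ n)"
      using x by (simp add: mult.assoc)
  qed simp
  also have "\<dots>\<^sup>2 \<le> (\<Sum>n<N. (cmod (a n) * sqrt (x ^ n / inv_sqrt_coeff n))\<^sup>2)
      * (\<Sum>n<N. (sqrt (inv_sqrt_coeff n * x ^ n))\<^sup>2)"
    by (rule Cauchy_Schwarz_ineq_sum)
  also have "\<dots> = (\<Sum>n<N. (cmod (a n))\<^sup>2 * (x ^ n / inv_sqrt_coeff n)) * (\<Sum>n<N. inv_sqrt_coeff n * x ^ n)"
    using x inv_sqrt_coeff_bounds(1) by (simp add: power_mult_distrib less_imp_le)
  also have "\<dots> \<le> (\<Sum>n<N. (cmod (a n))\<^sup>2 * (2 * sqrt (1 + real n) *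
        (2 * c powr (- 3 / 2) * (1 + real n * v) powr (- 3 / 2)))) * (c * v) powr (- 1 / 2)"
  proof (intro mult_mono sum_mono sum_nonneg)
    fix n
    have "x ^ n / inv_sqrt_coeff n = 1 / inv_sqrt_coeff n * x ^ n" by simp
    also have "\<dots> \<le> 2 * sqrt (1 + real n) * (2 * c powr (- 3 / 2) * (1 + real n * v) powr (- 3 / 2))"
      using x c v by (intro mult_mono inv_sqrt_coeff_bounds power_le_powr_three_halves) auto
    finally show "x ^ n / inv_sqrt_coeff n
      \<le> 2 * sqrt (1 + real n) * (2 * c powr (- 3 / 2) * (1 + real n * v) powr (- 3 / 2))" .
  next
    have "(\<Sum>n<N. inv_sqrt_coeff n * x ^ n) \<le> (\<Sum>n. inv_sqrt_coeff n * x ^ n)"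
      using inv_sqrt_coeff_sums[OF x(1,2)] x inv_sqrt_coeff_bounds(1)
      by (intro sum_le_suminf) (auto simp: sums_iff less_imp_le)
    also have "\<dots> = (1 - x) powr (- 1 / 2)"
      using inv_sqrt_coeff_sums[OF x(1,2)] by (simp add: sums_iff)
    also have "\<dots> \<le> (c * v) powr (- 1 / 2)"
      using x c v by (intro powr_mono2') auto
    finally show "(\<Sum>n<N. inv_sqrt_coeff n * x ^ n) \<le> (c * v) powr (- 1 / 2)" .
  qed (use x c v inv_sqrt_coeff_bounds(1) in \<open>auto simp: less_imp_le\<close>)
  finally have P: "(cmod (\<Sum>n<N. a n * lens_map \<theta> z ^ n))\<^sup>2 \<le>
      (\<Sum>n<N. (cmod (a n))\<^sup>2 * (2 * sqrt (1 + real n) *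
        (2 * c powr (- 3 / 2) * (1 + real n * v) powr (- 3 / 2)))) * (c * v) powr (- 1 / 2)" .
  have W: "(cmod ((1 - lens_map \<theta> z) powr of_real ((1 - 1 / \<theta>) / 2)))\<^sup>2 \<le> 2 * u powr (\<theta> - 1)"
    using lens_weight_polar_bound[OF \<theta> r t] by (simp add: z_def u_def)
  have "(cmod ((1 - lens_map \<theta> z) powr of_real ((1 - 1 / \<theta>) / 2) * (\<Sum>n<N. a n * lens_map \<theta> z ^ n)))\<^sup>2
     \<le> (2 * u powr (\<theta> - 1)) * ((\<Sum>n<N. (cmod (a n))\<^sup>2 * (2 * sqrt (1 + real n) *
        (2 * c powr (- 3 / 2) * (1 + real n * v) powr (- 3 / 2)))) * (c * v) powr (- 1 / 2))"
    unfolding norm_mult power_mult_distrib by (intro mult_mono P W) auto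
  also have "\<dots> = (\<Sum>n<N. 8 * c powr (- 2) * (cmod (a n))\<^sup>2 * sqrt (1 + real n) * singular_weight \<theta> n u)"
  proof -
    have 1: "u powr (\<theta> - 1) * (c * v) powr (- 1 / 2) = c powr (- 1 / 2) * u powr (\<theta> / 2 - 1)"
    proof -
      have "(c * v) powr (- 1 / 2) = c powr (- 1 / 2) * u powr (- \<theta> / 2)"
        using c u by (simp add: powr_mult v_def powr_powr)
      moreover have "u powr (\<theta> - 1) * u powr (- \<theta> / 2) = u powr (\<theta> / 2 - 1)"
        by (simp add: powr_add[symmetric] field_simps)
      ultimately show ?thesis by (simp add: mult_ac)
    qed
    have 2: "c powr (- 3 / 2) * c powr (- 1 / 2) = c powr (- 2)"
      by (simp add: powr_add[symmetric])
    have "(2 * u powr (\<theta> - 1)) * ((cmod (a n))\<^sup>2 * (2 * sqrt (1 + real n) *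
        (2 * c powr (- 3 / 2) * (1 + real n * v) powr (- 3 / 2))) * (c * v) powr (- 1 / 2))
      = 8 * c powr (- 2) * (cmod (a n))\<^sup>2 * sqrt (1 + real n) * singular_weight \<theta> n u" for n
    proof -
      have "(2 * u powr (\<theta> - 1)) * ((cmod (a n))\<^sup>2 * (2 * sqrt (1 + real n) *
        (2 * c powr (- 3 / 2) * (1 + real n * v) powr (- 3 / 2))) * (c * v) powr (- 1 / 2))
        = 8 * (u powr (\<theta> - 1) * (c * v) powr (- 1 / 2)) * c powr (- 3 / 2) *
          ((cmod (a n))\<^sup>2 * sqrt (1 + real n) * (1 + real n * v) powr (- 3 / 2))"
        by (simp only: mult_ac)
      also have "\<dots> = 8 * (c powr (- 3 / 2) * c powr (- 1 / 2)) * (cmod (a n))\<^sup>2 * sqrt (1 + real n) *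
          (u powr (\<theta> / 2 - 1) * (1 + real n * v) powr (- 3 / 2))"
        unfolding 1 by (simp only: mult_ac)
      finally show ?thesis
        unfolding 2 by (simp add: singular_weight_def v_def)
    qed
    then show ?thesis
      unfolding sum_distrib_left sum_distrib_right by (intro sum.cong refl)
  qed
  finally show ?thesis by (simp add: u_def c_def)
qed

text \<open>The pointwise estimate is summed over all n and integrated term by term. The factor
  \<open>sqrt (1 + real n)\<close> from the Schur weights cancels against the decay of the circle
  integral, leaving a multiple of the coefficient norm of f.\<close>

lemma weighted_lens_bounded:
  "\<exists>C\<ge>0. \<forall>f\<in>hardy2.
     (\<lambda>z. (1 - lens_map \<theta> z) powr of_real ((1 - 1 / \<theta>) / 2) * f (lens_map \<theta> z)) \<in> hardy2 \<and>
     (hardy_norm (\<lambda>z. (1 - lens_map \<theta> z) powr of_real ((1 - 1 / \<theta>) / 2) * f (lens_map \<theta> z)))\<^sup>2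
       \<le> C * (hardy_norm f)\<^sup>2"
proof -
  define K where "K = 8 * (cos (\<theta> * pi / 2) / 4) powr (- 2)"
  define w where "w = (\<lambda>z. (1 - lens_map \<theta> z) powr of_real ((1 - 1 / \<theta>) / 2))"
  have K: "0 \<le> K" by (simp add: K_def)
  have "(\<lambda>z. w z * f (lens_map \<theta> z)) \<in> hardy2 \<and>
     (hardy_norm (\<lambda>z. w z * f (lens_map \<theta> z)))\<^sup>2 \<le> K * (16 / \<theta>) * (hardy_norm f)\<^sup>2" if f: "f \<in> hardy2" for f
  proof -
    let ?F = "\<lambda>z. w z * f (lens_map \<theta> z)"
    define a where "a = taylor_coeff f"
    define b where "b n = K * (cmod (a n))\<^sup>2 * sqrt (1 + real n)" for n
    have b: "0 \<le> b n" for n using K by (simp add: b_def)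
    have hol: "?F holomorphic_on ball 0 1"
      unfolding w_def using \<theta> f
      by (intro holomorphic_on_mult lens_weight_holomorphic comp_lens_map_holomorphic hardy2_holomorphic)
    have M: "0 \<le> K * (16 / \<theta>) * (hardy_norm f)\<^sup>2" using K \<theta> by simp
    have "(\<integral>\<^sup>+ t. indicator circle_interval t * ennreal ((cmod (?F (of_real r * cis t)))\<^sup>2) \<partial>lborel)
      \<le> ennreal (K * (16 / \<theta>) * (hardy_norm f)\<^sup>2)" if r: "0 < r" "r < 1" for r
    proof -
      have "(\<integral>\<^sup>+ t. indicator circle_interval t * ennreal ((cmod (?F (of_real r * cis t)))\<^sup>2) \<partial>lborel)
        \<le> (\<integral>\<^sup>+ t. (\<Sum>n. ennreal (b n) * (indicator circle_interval t * ennreal (singular_weight \<theta> n \<bar>sin t\<bar>))) \<partial>lborel)"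
      proof (rule nn_integral_mono_AE, use AE_sin_nonzero in eventually_elim)
        fix t :: real assume t: "sin t \<noteq> 0"
        \<comment> \<open>The estimate is available for Taylor sections only; it passes to f in the
          limit, with the bounding series taken in \<open>ennreal\<close>, where it always has a
          value.\<close>
        let ?z = "of_real r * cis t"
        have lim: "(\<lambda>N. ennreal ((cmod (w ?z * (\<Sum>n<N. a n * lens_map \<theta> ?z ^ n)))\<^sup>2)) \<longlonglongrightarrow> ennreal ((cmod (?F ?z))\<^sup>2)"
          using taylor_sums[OF hardy2_holomorphic[OF f] lens_map_in_disk[OF \<theta> norm_rcis_lt_1[OF r, of t]]]
          by (intro tendsto_ennrealI tendsto_intros) (simp add: a_def sums_def)
        have "ennreal ((cmod (?F ?z))\<^sup>2) \<le> (\<Sum>n. ennreal (b n * singular_weight \<theta> n \<bar>sin t\<bar>))"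
        proof (rule LIMSEQ_le_const2[OF lim], intro exI allI impI)
          fix N
          have "ennreal ((cmod (w ?z * (\<Sum>n<N. a n * lens_map \<theta> ?z ^ n)))\<^sup>2)
            \<le> ennreal (\<Sum>n<N. b n * singular_weight \<theta> n \<bar>sin t\<bar>)"
            using weighted_partial_sum_bound[OF r t, where a = a and N = N]
            by (intro ennreal_leI) (simp add: w_def b_def K_def)
          also have "\<dots> = (\<Sum>n<N. ennreal (b n * singular_weight \<theta> n \<bar>sin t\<bar>))"
            using b by (simp add: sum_ennreal)
          also have "\<dots> \<le> (\<Sum>n. ennreal (b n * singular_weight \<theta> n \<bar>sin t\<bar>))"
            by (rule sum_le_suminf) auto
          finally show "ennreal ((cmod (w ?z * (\<Sum>n<N. a n * lens_map \<theta> ?z ^ n)))\<^sup>2)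
            \<le> (\<Sum>n. ennreal (b n * singular_weight \<theta> n \<bar>sin t\<bar>))" .
        qed
        then show "indicator circle_interval t * ennreal ((cmod (?F ?z))\<^sup>2)
          \<le> (\<Sum>n. ennreal (b n) * (indicator circle_interval t * ennreal (singular_weight \<theta> n \<bar>sin t\<bar>)))"
          using b by (cases "t \<in> circle_interval") (simp_all add: ennreal_mult)
      qed
      also have "\<dots> = (\<Sum>n. (\<integral>\<^sup>+ t. ennreal (b n) * (indicator circle_interval t * ennreal (singular_weight \<theta> n \<bar>sin t\<bar>)) \<partial>lborel))"
        by (rule nn_integral_suminf) (simp add: circle_interval_def)
      also have "\<dots> = (\<Sum>n. ennreal (b n) * (\<integral>\<^sup>+ t. indicator circle_interval t * ennreal (singular_weight \<theta> n \<bar>sin t\<bar>) \<partial>lborel))"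
        by (simp add: nn_integral_cmult circle_interval_def)
      also have "\<dots> \<le> (\<Sum>n. ennreal (b n) * ennreal (16 / \<theta> / sqrt (1 + real n)))"
        using \<theta> by (intro suminf_le mult_left_mono singular_weight_circle_integral) auto
      also have "\<dots> = (\<Sum>n. ennreal (K * (16 / \<theta>) * (cmod (a n))\<^sup>2))"
      proof -
        have "b n * (16 / \<theta> / sqrt (1 + real n)) = K * (16 / \<theta>) * (cmod (a n))\<^sup>2" for n
        proof -
          have "sqrt (1 + real n) \<noteq> 0" by simp
          then show ?thesis by (simp add: b_def)
        qed
        then show ?thesis using b \<theta> by (simp add: ennreal_mult[symmetric])
      qed
      also have "\<dots> = ennreal (\<Sum>n. K * (16 / \<theta>) * (cmod (a n))\<^sup>2)"
        using K \<theta> hardy2_summable[OF f] by (intro suminf_ennreal2 summable_mult) (auto simp: a_def)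
      also have "(\<Sum>n. K * (16 / \<theta>) * (cmod (a n))\<^sup>2) = K * (16 / \<theta>) * (hardy_norm f)\<^sup>2"
        unfolding hardy_norm_power2[OF f] a_def by (rule suminf_mult[OF hardy2_summable[OF f]])
      finally show ?thesis .
    qed
    from hardy2_if_circle_means_bounded[OF hol M this] show ?thesis by auto
  qed
  moreover have "0 \<le> K * (16 / \<theta>)" using K \<theta> by simp
  ultimately show ?thesis unfolding w_def by blast
qed

end

lemma hardy2_cmult:
  assumes "f \<in> hardy2"
  shows "(\<lambda>z. c * f z) \<in> hardy2"
    and "(hardy_norm (\<lambda>z. c * f z))\<^sup>2 = (cmod c)\<^sup>2 * (hardy_norm f)\<^sup>2"
proof -
  have eq: "(cmod (taylor_coeff (\<lambda>z. c * f z) n))\<^sup>2 = (cmod c)\<^sup>2 * (cmod (taylor_coeff f n))\<^sup>2" for n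
    by (simp add: taylor_coeff_cmult hardy2_holomorphic[OF assms] norm_mult power_mult_distrib)
  show m: "(\<lambda>z. c * f z) \<in> hardy2"
    using assms hardy2_holomorphic[OF assms]
    by (auto simp: hardy2_def eq intro!: holomorphic_intros summable_mult)
  show "(hardy_norm (\<lambda>z. c * f z))\<^sup>2 = (cmod c)\<^sup>2 * (hardy_norm f)\<^sup>2"
    unfolding hardy_norm_power2[OF m] hardy_norm_power2[OF assms] eq
    by (rule suminf_mult[OF hardy2_summable[OF assms]])
qed

lemma hardy_norm_le:
  assumes "f \<in> hardy2" "(hardy_norm f)\<^sup>2 \<le> M"
  shows "hardy_norm f \<le> sqrt M"
  using real_sqrt_le_mono[OF assms(2)] assms(1) by simp

lemma bounded_hardy_op_if_power2:
  assumes "hardy_linear_op T" "0 \<le> C"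
    and "\<And>f. f \<in> hardy2 \<Longrightarrow> (hardy_norm (T f))\<^sup>2 \<le> C * (hardy_norm f)\<^sup>2"
  shows "bounded_hardy_op T"
proof -
  have "hardy_norm (T f) \<le> sqrt C * hardy_norm f" if "f \<in> hardy2" for f
    using hardy_norm_le[OF _ assms(3)[OF that]] assms(1) that
    by (simp add: hardy_linear_op_def real_sqrt_mult)
  with assms(1) show ?thesis unfolding bounded_hardy_op_def by blast
qed

section \<open>Boundedness and failure of compactness of the weighted operator\<close>

context
  fixes \<theta> :: real
  assumes \<theta>: "0 < \<theta>" "\<theta> < 1"
begin

lemma weighted_composition_bounded:
  "bounded_hardy_op (\<lambda>f z. (1 - lens_map \<theta> z) powr of_real ((1 - 1 / \<theta>) / 2) * f (lens_map \<theta> z))"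
proof -
  obtain C where C: "0 \<le> C" "\<And>f. f \<in> hardy2 \<Longrightarrow>
     (\<lambda>z. (1 - lens_map \<theta> z) powr of_real ((1 - 1 / \<theta>) / 2) * f (lens_map \<theta> z)) \<in> hardy2 \<and>
     (hardy_norm (\<lambda>z. (1 - lens_map \<theta> z) powr of_real ((1 - 1 / \<theta>) / 2) * f (lens_map \<theta> z)))\<^sup>2
       \<le> C * (hardy_norm f)\<^sup>2"
    using weighted_lens_bounded[OF \<theta>] by blast
  show ?thesis
  proof (rule bounded_hardy_op_if_power2[OF _ C(1)])
    show "hardy_linear_op (\<lambda>f z. (1 - lens_map \<theta> z) powr of_real ((1 - 1 / \<theta>) / 2) * f (lens_map \<theta> z))"
      unfolding hardy_linear_op_def
      using C(2) lens_map_in_disk[OF \<theta>] by (auto simp: algebra_simps)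
  qed (use C in blast)
qed

lemma lens_weight_hardy2:
  "(\<lambda>z. (1 - lens_map \<theta> z) powr of_real ((1 - 1 / \<theta>) / 2)) \<in> hardy2"
proof (rule hardy2_if_sin_majorant(1))
  show "0 < 1 - \<theta>" "1 - \<theta> < 1" "(0::real) \<le> 2" using \<theta> by auto
  show "(\<lambda>z. (1 - lens_map \<theta> z) powr of_real ((1 - 1 / \<theta>) / 2)) holomorphic_on ball 0 1"
    by (rule lens_weight_holomorphic[OF \<theta>])
qed (use lens_weight_polar_bound[OF \<theta>] in simp)

text \<open>A norm limit of images of the normalised kernels at \<open>p n\<close> would have to
  vanish pointwise. Point evaluation at \<open>x n\<close>, however, keeps the norms of those images
  away from 0: the exponent of the weight makes the kernel quotient (1 - x^2)/(1 - p^2) balance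
  exactly.\<close>

lemma weighted_composition_not_compact:
  "\<not> compact_hardy_op (\<lambda>f z. (1 - lens_map \<theta> z) powr of_real ((1 - 1 / \<theta>) / 2) * f (lens_map \<theta> z))"
proof
  define w where "w = (\<lambda>z. (1 - lens_map \<theta> z) powr of_real ((1 - 1 / \<theta>) / 2))"
  assume "compact_hardy_op (\<lambda>f z. (1 - lens_map \<theta> z) powr of_real ((1 - 1 / \<theta>) / 2) * f (lens_map \<theta> z))"
  then have comp: "compact_hardy_op (\<lambda>f z. w z * f (lens_map \<theta> z))"
    by (simp add: w_def)
  \<comment> \<open>This makes the Cayley transform of \<open>x n\<close> equal to 2n + 3;
    \<open>S n\<close> is its power and \<open>p n\<close> the lens image.\<close>
  define x where "x n = (real n + 1) / (real n + 2)" for n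
  define S where "S n = (2 * real n + 3) powr \<theta>" for n
  define p where "p n = (S n - 1) / (S n + 1)" for n
  define f where "f n z = of_real (sqrt (1 - (p n)\<^sup>2)) * (1 / (1 - of_real (p n) * z))" for n and z :: complex
  have x: "0 < x n" "x n < 1" for n by (auto simp: x_def)
  have xc: "(1 + x n) / (1 - x n) = 2 * real n + 3" for n
  proof -
    have "1 + x n = (2 * real n + 3) / (real n + 2)" "1 - x n = 1 / (real n + 2)"
      by (auto simp: x_def field_simps)
    then show ?thesis by simp
  qed
  have S: "1 \<le> S n" for n
    using \<theta> by (auto simp: S_def intro!: ge_one_powr_ge_zero)
  have Spos: "0 < S n" for n using S[of n] by linarith
  have p: "0 \<le> p n" "p n < 1" for n
    using S[of n] by (auto simp: p_def)
  have p1: "1 - p n \<le> 2 / S n" "0 < 1 - p n" for n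
    using S[of n] by (auto simp: p_def field_simps)
  have lp: "lens_map \<theta> (of_real (x n)) = of_real (p n)" for n
  proof -
    have "lens_power \<theta> (of_real (x n)) = of_real (S n)"
    proof -
      have "(1 + complex_of_real (x n)) / (1 - of_real (x n)) = of_real (2 * real n + 3)"
        unfolding xc[symmetric] by simp
      then have "lens_power \<theta> (of_real (x n)) = of_real (2 * real n + 3) powr of_real \<theta>"
        by (simp only: lens_power_def)
      also have "\<dots> = of_real (S n)"
        unfolding S_def by (rule powr_of_real) auto
      finally show ?thesis .
    qed
    then show ?thesis
      using lens_map_eq[OF \<theta>, of "of_real (x n)"] x[of n] by (simp add: p_def)
  qed
  have p2: "(p n)\<^sup>2 < 1" for n using p[of n] by (simp add: abs_square_less_1)
  have f2: "f n \<in> hardy2" "(hardy_norm (f n))\<^sup>2 = 1" for n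
  proof -
    have k: "cmod (of_real (p n)) < 1" using p[of n] by simp
    have fe: "f n = (\<lambda>z. of_real (sqrt (1 - (p n)\<^sup>2)) * (1 / (1 - of_real (p n) * z)))"
      by (simp add: f_def fun_eq_iff)
    show "f n \<in> hardy2" unfolding fe by (intro hardy2_cmult szego_kernel_hardy k)
    show "(hardy_norm (f n))\<^sup>2 = 1"
      unfolding fe hardy2_cmult(2)[OF szego_kernel_hardy(1)[OF k]] szego_kernel_hardy(2)[OF k]
      using p2[of n] by simp
  qed
  have "hardy_norm (f n) \<le> 1" for n
    using hardy_norm_le[OF f2(1), of n 1] f2(2) by simp
  with f2(1) comp obtain \<rho> g where g: "strict_mono \<rho>" "g \<in> hardy2"
      "(\<lambda>k. hardy_norm (\<lambda>z. w z * f (\<rho> k) (lens_map \<theta> z) - g z)) \<longlonglongrightarrow> 0"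
    unfolding compact_hardy_op_def by blast
  define D where "D k = (\<lambda>z. w z * f (\<rho> k) (lens_map \<theta> z) - g z)" for k
  have D: "D k \<in> hardy2" for k
  proof -
    have "(\<lambda>z. w z * f (\<rho> k) (lens_map \<theta> z)) \<in> hardy2"
      using weighted_composition_bounded f2(1) unfolding bounded_hardy_op_def hardy_linear_op_def w_def by blast
    then show ?thesis unfolding D_def by (rule hardy2_diff(1)[OF _ g(2)])
  qed
  have lim: "(\<lambda>k. (hardy_norm (D k))\<^sup>2) \<longlonglongrightarrow> 0"
    using tendsto_power[OF g(3), of 2] by (simp add: D_def)
  have S_lim: "(\<lambda>k. 4 / S (\<rho> k)) \<longlonglongrightarrow> 0"
  proof -
    have "(\<lambda>n. 4 / S n) \<longlonglongrightarrow> 0"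
      unfolding S_def using \<theta> by real_asymp
    then show ?thesis using LIMSEQ_subseq_LIMSEQ[OF _ g(1)] by (simp add: o_def)
  qed
  \<comment> \<open>Norm convergence forces pointwise convergence, and at the fixed point
    \<lambda>(z) the kernels tend to 0 because their normalising factor is at most
    \<open>sqrt (4 / S n)\<close>.\<close>
  have g0: "g z = 0" if z: "cmod z < 1" for z
  proof -
    let ?l = "lens_map \<theta> z"
    have l: "cmod ?l < 1" by (rule lens_map_in_disk[OF \<theta> z])
    have "(\<lambda>k. (cmod (D k z))\<^sup>2) \<longlonglongrightarrow> 0"
    proof (rule tendsto_sandwich[of "\<lambda>_. 0"])
      show "\<forall>\<^sub>F k in sequentially. (cmod (D k z))\<^sup>2 \<le> (hardy_norm (D k))\<^sup>2 / (1 - (cmod z)\<^sup>2)"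
        using hardy2_point_evaluation[OF D z] by simp
      show "(\<lambda>k. (hardy_norm (D k))\<^sup>2 / (1 - (cmod z)\<^sup>2)) \<longlonglongrightarrow> 0"
        using tendsto_divide_zero[OF lim] by simp
    qed auto
    then have D0: "(\<lambda>k. D k z) \<longlonglongrightarrow> 0"
      by (simp add: tendsto_norm_zero_iff)
    have "(\<lambda>k. f (\<rho> k) ?l) \<longlonglongrightarrow> 0"
    proof (rule Lim_null_comparison)
      have "cmod (f n ?l) \<le> sqrt (4 / S n) * (1 / (1 - cmod ?l))" for n
      proof -
        have "cmod (f n ?l) = sqrt (1 - (p n)\<^sup>2) * (1 / cmod (1 - of_real (p n) * ?l))"
          using p2[of n] by (simp add: f_def norm_mult norm_divide)
        also have "\<dots> \<le> sqrt (4 / S n) * (1 / (1 - cmod ?l))"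
        proof (intro mult_mono real_sqrt_le_mono divide_left_mono)
          have "1 - (p n)\<^sup>2 = (1 - p n) * (1 + p n)" by (simp add: power2_eq_square algebra_simps)
          also have "\<dots> \<le> (2 / S n) * 2" using p1[of n] p[of n] Spos[of n] by (intro mult_mono) auto
          finally show "1 - (p n)\<^sup>2 \<le> 4 / S n" by simp
          have "cmod (of_real (p n) * ?l) \<le> cmod ?l"
            using p[of n] mult_right_mono[of "p n" 1 "cmod ?l"] by (simp add: norm_mult)
          then show a: "1 - cmod ?l \<le> cmod (1 - of_real (p n) * ?l)"
            using norm_triangle_ineq2[of 1 "of_real (p n) * ?l"] by simp
          have "0 < 1 - cmod ?l" using l by simp
          with a show "0 < cmod (1 - of_real (p n) * ?l) * (1 - cmod ?l)"
            by (intro mult_pos_pos) linarith+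
        qed (use Spos[of n] in auto)
        finally show ?thesis .
      qed
      then show "\<forall>\<^sub>F k in sequentially. cmod (f (\<rho> k) ?l) \<le> sqrt (4 / S (\<rho> k)) * (1 / (1 - cmod ?l))"
        by simp
      show "(\<lambda>k. sqrt (4 / S (\<rho> k)) * (1 / (1 - cmod ?l))) \<longlonglongrightarrow> 0"
        using tendsto_real_sqrt[OF S_lim] by (intro tendsto_mult_left_zero) simp
    qed
    then have "(\<lambda>k. w z * f (\<rho> k) ?l - D k z) \<longlonglongrightarrow> w z * 0 - 0"
      using D0 by (intro tendsto_intros)
    then have "(\<lambda>k. g z) \<longlonglongrightarrow> 0" by (simp add: D_def)
    then show ?thesis by (simp add: LIMSEQ_const_iff)
  qed
  \<comment> \<open>As g vanishes, \<open>D k\<close> at \<open>x n\<close> is the weight times the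
    kernel value, with squared modulus W/(1 - p^2). The remaining computation bounds this times 1 -
    x^2 from below.\<close>
  have lower: "2 powr (- 1 / \<theta>) / 2 \<le> (hardy_norm (D k))\<^sup>2" for k
  proof -
    define n where "n = \<rho> k"
    have z: "cmod (of_real (x n)) < 1" using x[of n] by simp
    have x2: "(x n)\<^sup>2 < 1" using x[of n] by (simp add: abs_square_less_1)
    define W where "W = (1 - p n) powr (1 - 1 / \<theta>)"
    have "cmod (w (of_real (x n))) = (1 - p n) powr ((1 - 1 / \<theta>) / 2)"
    proof -
      have "1 - complex_of_real (p n) = of_real (1 - p n)" by simp
      then show ?thesis unfolding w_def lp
        using p1(2)[of n] by (subst norm_powr_real_powr') (simp_all del: of_real_diff)
    qed
    then have w2: "(cmod (w (of_real (x n))))\<^sup>2 = W"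
      using p1(2)[of n] by (simp add: W_def power2_eq_square powr_add[symmetric])
    have "f n (of_real (p n)) = of_real (sqrt (1 - (p n)\<^sup>2) / (1 - (p n)\<^sup>2))"
      by (simp add: f_def power2_eq_square)
    then have "(cmod (f n (of_real (p n))))\<^sup>2 = (sqrt (1 - (p n)\<^sup>2) / (1 - (p n)\<^sup>2))\<^sup>2"
      by (simp only: norm_of_real power2_abs)
    also have "\<dots> = 1 / (1 - (p n)\<^sup>2)"
      using p2[of n] by (simp add: power_divide power2_eq_square[of "1 - (p n)\<^sup>2"])
    finally have "(cmod (D k (of_real (x n))))\<^sup>2 = W / (1 - (p n)\<^sup>2)"
      using w2 by (simp add: D_def g0[OF z] lp norm_mult power_mult_distrib flip: n_def)
    with hardy2_point_evaluation[OF D z, of k]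
    have "W / (1 - (p n)\<^sup>2) \<le> (hardy_norm (D k))\<^sup>2 / (1 - (x n)\<^sup>2)" by simp
    then have le: "W / (1 - (p n)\<^sup>2) * (1 - (x n)\<^sup>2) \<le> (hardy_norm (D k))\<^sup>2"
      using x2 by (simp add: pos_le_divide_eq)
    \<comment> \<open>The inserted factor (1+x)/(1-x) equals \<open>S n powr (1 / \<theta>)\<close>.
      It turns the constant into a power of 2/S, which compares with 1 - p through
      \<open>p1\<close>; the exponent is negative.\<close>
    have "2 powr (- 1 / \<theta>) / 2 = 2 powr (- 1 / \<theta>) * ((1 + x n) / (1 - x n)) * ((1 - x n) / (1 + x n)) / 2"
      using x[of n] by simp
    also have "\<dots> \<le> 2 powr (- 1 / \<theta>) * ((1 + x n) / (1 - x n)) * (1 - x n) / 2"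
      using x[of n] by (intro divide_right_mono mult_left_mono) (auto simp: divide_simps)
    also have "2 powr (- 1 / \<theta>) * ((1 + x n) / (1 - x n)) = (2 / S n) powr (- 1 / \<theta>)"
    proof -
      have "S n powr (1 / \<theta>) = (1 + x n) / (1 - x n)"
        using \<theta> unfolding xc by (simp add: S_def powr_powr)
      then show ?thesis
        using Spos[of n] by (simp add: powr_divide powr_minus_divide)
    qed
    also have "(2 / S n) powr (- 1 / \<theta>) * (1 - x n) / 2 \<le> (1 - p n) powr (- 1 / \<theta>) * (1 - x n) / 2"
      using p1[of n] x[of n] \<theta> by (intro divide_right_mono mult_right_mono powr_mono2') auto
    also have "\<dots> \<le> (1 - p n) powr (- 1 / \<theta>) * (1 - x n) * ((1 + x n) / (1 + p n))"
    proof -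
      have "1 / 2 \<le> (1 + x n) / (1 + p n)"
        using x[of n] p[of n] by (intro frac_le) auto
      from mult_left_mono[OF this, of "(1 - p n) powr (- 1 / \<theta>) * (1 - x n)"] x[of n]
      show ?thesis by simp
    qed
    also have "\<dots> = W / (1 - (p n)\<^sup>2) * (1 - (x n)\<^sup>2)"
    proof -
      have "W = (1 - p n) * (1 - p n) powr (- 1 / \<theta>)"
        using p1(2)[of n] powr_add[of "1 - p n" 1 "- 1 / \<theta>"] by (simp add: W_def)
      moreover have "1 - (p n)\<^sup>2 = (1 - p n) * (1 + p n)" "1 - (x n)\<^sup>2 = (1 - x n) * (1 + x n)"
        by (auto simp: power2_eq_square algebra_simps)
      ultimately show ?thesis using p1(2)[of n] p[of n] by simp
    qed
    also note le
    finally show ?thesis .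
  qed
  have "2 powr (- 1 / \<theta>) / 2 \<le> 0"
    by (rule LIMSEQ_le_const[OF lim]) (use lower in auto)
  then show False by (simp add: not_le[symmetric])
qed

end

section \<open>Blaschke expansions\<close>

definition blaschke_factor :: "real \<Rightarrow> complex \<Rightarrow> complex" where
  "blaschke_factor p z = (z - of_real p) / (1 - of_real p * z)"

text \<open>The function L f in f = (1 - p^2) f(p) / (1 - pz) + b L f, where b is the Blaschke
  factor with zero p. The first summand is the orthogonal projection of f onto the reproducing
  kernel at p. The derivative fills the removable singularity.\<close>

definition blaschke_quotient :: "real \<Rightarrow> (complex \<Rightarrow> complex) \<Rightarrow> complex \<Rightarrow> complex" where
  "blaschke_quotient p f z =
     (if z = of_real p then deriv (\<lambda>z. (1 - of_real p * z) * f z) (of_real p)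
      else ((1 - of_real p * z) * f z - (1 - of_real p * of_real p) * f (of_real p)) / (z - of_real p))"

lemma one_minus_mult_nonzero:
  assumes "\<bar>p\<bar> < 1" "cmod z < 1"
  shows "1 - \<bar>p\<bar> \<le> cmod (1 - of_real p * z)" "1 - of_real p * z \<noteq> 0"
proof -
  have "cmod (of_real p * z) \<le> \<bar>p\<bar>"
    using assms mult_left_mono[of "cmod z" 1 "\<bar>p\<bar>"] by (simp add: norm_mult)
  then show "1 - \<bar>p\<bar> \<le> cmod (1 - of_real p * z)"
    using norm_triangle_ineq2[of 1 "of_real p * z"] by simp
  then show "1 - of_real p * z \<noteq> 0" using assms by auto
qed

text \<open>Rests on |1 - pz|^2 - |z - p|^2 = (1 - p^2)(1 - |z|^2).\<close>

lemma blaschke_factor_le_1: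
  assumes "\<bar>p\<bar> < 1" "cmod z < 1"
  shows "cmod (blaschke_factor p z) \<le> 1"
proof -
  have "(cmod (1 - of_real p * z))\<^sup>2 - (cmod (z - of_real p))\<^sup>2 = (1 - p\<^sup>2) * (1 - (cmod z)\<^sup>2)"
    unfolding cmod_power2 by (simp add: power2_eq_square algebra_simps)
  moreover have "0 \<le> (1 - p\<^sup>2) * (1 - (cmod z)\<^sup>2)"
    using assms by (intro mult_nonneg_nonneg) (auto simp: abs_square_le_1 power_le_one)
  ultimately have "(cmod (z - of_real p))\<^sup>2 \<le> (cmod (1 - of_real p * z))\<^sup>2" by linarith
  then have "cmod (z - of_real p) \<le> cmod (1 - of_real p * z)"
    by (rule power2_le_imp_le) simp
  then show ?thesis
    using one_minus_mult_nonzero[OF assms] by (simp add: blaschke_factor_def norm_divide)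
qed

lemma blaschke_factor_holomorphic:
  "\<bar>p\<bar> < 1 \<Longrightarrow> blaschke_factor p holomorphic_on ball 0 1"
  unfolding blaschke_factor_def[abs_def]
  using one_minus_mult_nonzero by (intro holomorphic_intros) auto

lemma blaschke_quotient_holomorphic:
  assumes "f holomorphic_on ball 0 1"
  shows "blaschke_quotient p f holomorphic_on ball 0 1"
proof -
  have "(\<lambda>z. (1 - of_real p * z) * f z) holomorphic_on ball 0 1"
    by (intro holomorphic_intros assms)
  from pole_lemma_open[OF this, of "of_real p"] show ?thesis
    by (simp add: blaschke_quotient_def[abs_def])
qed

lemma blaschke_quotient_eq:
  "(z - of_real p) * blaschke_quotient p f z = (1 - of_real p * z) * f z - (1 - of_real (p\<^sup>2)) * f (of_real p)"
  by (simp add: blaschke_quotient_def power2_eq_square)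

text \<open>Off p the equation determines the quotient, and at p continuity does. Linearity of the
  quotient follows from this without handling the derivative in its definition.\<close>

lemma blaschke_quotient_unique:
  assumes p: "\<bar>p\<bar> < 1" and f: "f holomorphic_on ball 0 1" and g: "g holomorphic_on ball 0 1"
    and eq: "\<And>z. cmod z < 1 \<Longrightarrow> (z - of_real p) * g z = (1 - of_real p * z) * f z - (1 - of_real (p\<^sup>2)) * f (of_real p)"
    and z: "cmod z < 1"
  shows "blaschke_quotient p f z = g z"
proof -
  define d where "d z = blaschke_quotient p f z - g z" for z
  have d0: "d z = 0" if "cmod z < 1" "z \<noteq> of_real p" for z
  proof -
    have "(z - of_real p) * d z = 0"
      using eq[OF that(1)] blaschke_quotient_eq[of z p f] by (simp add: d_def right_diff_distrib)
    with that show ?thesis by simp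
  qed
  have "d holomorphic_on ball 0 1"
    unfolding d_def by (intro holomorphic_intros blaschke_quotient_holomorphic f g)
  then have "isCont d (of_real p)"
    using p by (intro continuous_on_interior[OF holomorphic_on_imp_continuous_on]) (auto simp: interior_open)
  then have "(d \<longlongrightarrow> d (of_real p)) (at (of_real p))"
    by (simp add: isCont_def)
  moreover have "(d \<longlongrightarrow> 0) (at (of_real p))"
  proof (rule tendsto_eventually)
    have "\<forall>\<^sub>F z in at (complex_of_real p). z \<in> ball 0 1 - {of_real p}"
      using p by (intro eventually_at_in_open) auto
    then show "\<forall>\<^sub>F z in at (of_real p). d z = 0"
      by eventually_elim (use d0 in auto)
  qed
  ultimately have "d (of_real p) = 0"
    using tendsto_unique trivial_limit_at by blast
  then show ?thesis
    using d0[OF z] by (cases "z = of_real p") (auto simp: d_def)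
qed

lemma norm_square_reflection:
  fixes a b :: complex and p :: real
  shows "(cmod (b + of_real p * a))\<^sup>2 - (cmod (a + of_real p * b))\<^sup>2 = (1 - p\<^sup>2) * ((cmod b)\<^sup>2 - (cmod a)\<^sup>2)"
  unfolding cmod_power2 by (simp add: power2_eq_square algebra_simps)

text \<open>In coefficients, \<open>e\<^sub>n = a\<^sub>n + p b\<^sub>n\<close> satisfies \<open>e\<^sub>n\<^sub>+\<^sub>1 = b\<^sub>n + p a\<^sub>n\<close>, so the reflection identity
  telescopes.\<close>

lemma blaschke_quotient_hardy:
  assumes p: "\<bar>p\<bar> < 1" and f: "f \<in> hardy2"
  shows "blaschke_quotient p f \<in> hardy2"
    and "(hardy_norm (blaschke_quotient p f))\<^sup>2 \<le> (hardy_norm f)\<^sup>2"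
proof -
  let ?g = "blaschke_quotient p f"
  have holf: "f holomorphic_on ball 0 1" by (rule hardy2_holomorphic[OF f])
  have holg: "?g holomorphic_on ball 0 1" by (rule blaschke_quotient_holomorphic[OF holf])
  define a where "a = taylor_coeff f"
  define b where "b = taylor_coeff ?g"
  define C where "C = (1 - of_real (p\<^sup>2)) * f (of_real p)"
  let ?A = "Abs_fps a" and ?B = "Abs_fps b"
  have "(\<lambda>z. (z - of_real p) * ?g z) has_fps_expansion (fps_X - fps_const (of_real p)) * ?B"
    unfolding b_def by (intro fps_expansion_intros holomorphic_has_taylor_expansion holg)
  moreover have "(\<lambda>z. (1 - of_real p * z) * f z - C) has_fps_expansion
      (1 - fps_const (of_real p) * fps_X) * ?A - fps_const C"
    unfolding a_def by (intro fps_expansion_intros holomorphic_has_taylor_expansion holf)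
  moreover have "(\<lambda>z. (z - of_real p) * ?g z) = (\<lambda>z. (1 - of_real p * z) * f z - C)"
    by (simp add: blaschke_quotient_eq C_def)
  ultimately have "(fps_X - fps_const (of_real p)) * ?B = (1 - fps_const (of_real p) * fps_X) * ?A - fps_const C"
    using fps_expansion_unique_complex by metis
  then have nth: "fps_nth ((fps_X - fps_const (of_real p)) * ?B) n =
      fps_nth ((1 - fps_const (of_real p) * fps_X) * ?A - fps_const C) n" for n by simp
  have rec0: "a 0 + of_real p * b 0 = C"
    using nth[of 0] by (simp add: left_diff_distrib mult.assoc algebra_simps)
  have rec: "b n + of_real p * a n = a (Suc n) + of_real p * b (Suc n)" for n
    using nth[of "Suc n"] by (simp add: left_diff_distrib mult.assoc algebra_simps)
  define e where "e n = a n + of_real p * b n" for n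
  have p2: "0 < 1 - p\<^sup>2" using p by (simp add: abs_square_less_1)
  have tele: "(1 - p\<^sup>2) * (\<Sum>n<N. (cmod (b n))\<^sup>2) = (1 - p\<^sup>2) * (\<Sum>n<N. (cmod (a n))\<^sup>2) + (cmod (e N))\<^sup>2 - (cmod C)\<^sup>2" for N
  proof (induction N)
    case 0
    show ?case using rec0 by (simp add: e_def)
  next
    case (Suc N)
    have "(cmod (e (Suc N)))\<^sup>2 - (cmod (e N))\<^sup>2 = (1 - p\<^sup>2) * ((cmod (b N))\<^sup>2 - (cmod (a N))\<^sup>2)"
      using norm_square_reflection[of "b N" p "a N"] rec[of N] by (simp add: e_def)
    with Suc show ?case by (simp add: algebra_simps)
  qed
  have suma: "summable (\<lambda>n. (cmod (a n))\<^sup>2)"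
    using hardy2_summable[OF f] by (simp add: a_def)
  have a0: "a \<longlonglongrightarrow> 0"
    using summable_LIMSEQ_zero[OF suma] by (simp add: tendsto_norm_zero_iff)
  \<comment> \<open>The telescoped identity contains \<open>e N\<close>, hence \<open>b N\<close>,
    whose boundedness is not yet known. It comes from the recursion
    \<open>b n = p * b (Suc n) + d n\<close> with d bounded, iterated forward.\<close>
  define d where "d n = a (Suc n) - of_real p * a n" for n
  have bd: "b n = of_real p * b (Suc n) + d n" for n
    using rec[of n] by (simp add: d_def algebra_simps)
  have "d \<longlonglongrightarrow> 0 - of_real p * 0"
    unfolding d_def by (intro tendsto_intros LIMSEQ_Suc a0)
  then have "Bseq d"
    by (intro convergent_imp_Bseq) (auto simp: convergent_def)
  then obtain D where D: "0 < D" "\<And>n. cmod (d n) \<le> D"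
    by (auto simp: Bseq_def)
  define q where "q = (1 + \<bar>p\<bar>) / 2"
  have q: "0 < q" "q < 1" "\<bar>p\<bar> \<le> q" using p by (auto simp: q_def)
  have it: "cmod (b n) \<le> q ^ k * cmod (b (n + k)) + D * (\<Sum>j<k. q ^ j)" for n k
  proof (induction k)
    case (Suc k)
    have "cmod (b (n + k)) \<le> cmod (of_real p * b (Suc (n + k))) + cmod (d (n + k))"
      by (subst bd) (rule norm_triangle_ineq)
    also have "\<dots> \<le> q * cmod (b (Suc (n + k))) + D"
      using q D by (intro add_mono) (auto simp: norm_mult intro: mult_right_mono)
    finally have "q ^ k * cmod (b (n + k)) \<le> q ^ k * (q * cmod (b (Suc (n + k))) + D)"
      using q by (intro mult_left_mono) auto
    with Suc show ?case by (simp add: algebra_simps)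
  qed simp
  have b_le: "cmod (b n) \<le> D / (1 - q)" for n
  proof -
    \<comment> \<open>The quotient is holomorphic in the whole disk, so its Taylor series converges
      at q < 1. Divided by \<open>q ^ n\<close>, this removes the first term of \<open>it\<close> as
      k grows.\<close>
    have "(\<lambda>m. b m * of_real q ^ m) \<longlonglongrightarrow> 0"
      using taylor_sums[OF holg, of "of_real q"] q
      by (intro summable_LIMSEQ_zero) (auto simp: b_def sums_iff)
    then have "(\<lambda>m. cmod (b m * of_real q ^ m)) \<longlonglongrightarrow> 0"
      by (rule tendsto_norm_zero)
    then have "(\<lambda>k. cmod (b (k + n) * of_real q ^ (k + n))) \<longlonglongrightarrow> 0"
      by (rule LIMSEQ_ignore_initial_segment)
    from tendsto_mult_right_zero[OF this, of "1 / q ^ n"]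
    have lim: "(\<lambda>k. q ^ k * cmod (b (n + k))) \<longlonglongrightarrow> 0"
      using q by (simp add: norm_mult norm_power power_add add.commute mult_ac)
    have "cmod (b n) \<le> 0 + D / (1 - q)"
    proof (rule LIMSEQ_le_const)
      show "(\<lambda>k. q ^ k * cmod (b (n + k)) + D / (1 - q)) \<longlonglongrightarrow> 0 + D / (1 - q)"
        by (intro tendsto_intros lim)
      have "cmod (b n) \<le> q ^ k * cmod (b (n + k)) + D / (1 - q)" for k
      proof -
        have "(\<Sum>j<k. q ^ j) \<le> (\<Sum>j. q ^ j)"
          using q by (intro sum_le_suminf summable_geometric) auto
        also have "\<dots> = 1 / (1 - q)"
          using q by (intro suminf_geometric) auto
        finally have "D * (\<Sum>j<k. q ^ j) \<le> D * (1 / (1 - q))"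
          using D by (intro mult_left_mono) auto
        with it[of n k] show ?thesis by simp
      qed
      then show "\<exists>N. \<forall>k\<ge>N. cmod (b n) \<le> q ^ k * cmod (b (n + k)) + D / (1 - q)" by blast
    qed
    then show ?thesis by simp
  qed
  have sumb: "summable (\<lambda>n. (cmod (b n))\<^sup>2)"
  proof (rule summableI_nonneg_bounded)
    fix N
    have "cmod (a N) \<le> hardy_norm f"
    proof (rule power2_le_imp_le)
      have "(\<Sum>n\<in>{N}. (cmod (a n))\<^sup>2) \<le> (\<Sum>n. (cmod (a n))\<^sup>2)"
        by (intro sum_le_suminf suma) auto
      then show "(cmod (a N))\<^sup>2 \<le> (hardy_norm f)\<^sup>2"
        by (simp add: hardy_norm_power2[OF f] a_def)
    qed (simp add: f)
    moreover have "cmod (of_real p * b N) \<le> 1 * (D / (1 - q))"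
      unfolding norm_mult using p b_le[of N] by (intro mult_mono) auto
    ultimately have "cmod (e N) \<le> hardy_norm f + D / (1 - q)"
      unfolding e_def using norm_triangle_ineq[of "a N" "of_real p * b N"] by simp
    then have "(cmod (e N))\<^sup>2 \<le> (hardy_norm f + D / (1 - q))\<^sup>2"
      by (intro power_mono) auto
    moreover have "(\<Sum>n<N. (cmod (a n))\<^sup>2) \<le> (hardy_norm f)\<^sup>2"
      unfolding hardy_norm_power2[OF f] a_def[symmetric] by (intro sum_le_suminf suma) auto
    then have "(1 - p\<^sup>2) * (\<Sum>n<N. (cmod (a n))\<^sup>2) \<le> (1 - p\<^sup>2) * (hardy_norm f)\<^sup>2"
      using p2 by (intro mult_left_mono) auto
    ultimately have "(1 - p\<^sup>2) * (\<Sum>n<N. (cmod (b n))\<^sup>2)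
        \<le> (1 - p\<^sup>2) * (hardy_norm f)\<^sup>2 + (hardy_norm f + D / (1 - q))\<^sup>2"
      using tele[of N] zero_le_power2[of "cmod C"] by linarith
    then show "(\<Sum>n<N. (cmod (b n))\<^sup>2)
        \<le> ((1 - p\<^sup>2) * (hardy_norm f)\<^sup>2 + (hardy_norm f + D / (1 - q))\<^sup>2) / (1 - p\<^sup>2)"
      using p2 by (simp add: pos_le_divide_eq mult.commute)
  qed simp
  show g2: "?g \<in> hardy2"
    using sumb holg by (simp add: hardy2_def b_def)
  have b0: "b \<longlonglongrightarrow> 0"
    using summable_LIMSEQ_zero[OF sumb] by (simp add: tendsto_norm_zero_iff)
  have e0: "(\<lambda>N. (cmod (e N))\<^sup>2) \<longlonglongrightarrow> (cmod (0 + of_real p * 0))\<^sup>2"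
    unfolding e_def by (intro tendsto_intros a0 b0)
  have "(\<lambda>N. (1 - p\<^sup>2) * (\<Sum>n<N. (cmod (b n))\<^sup>2)) \<longlonglongrightarrow> (1 - p\<^sup>2) * (\<Sum>n. (cmod (b n))\<^sup>2)"
    by (intro tendsto_intros summable_LIMSEQ sumb)
  moreover have "(\<lambda>N. (1 - p\<^sup>2) * (\<Sum>n<N. (cmod (a n))\<^sup>2) + (cmod (e N))\<^sup>2 - (cmod C)\<^sup>2) \<longlonglongrightarrow>
      (1 - p\<^sup>2) * (\<Sum>n. (cmod (a n))\<^sup>2) + (cmod (0 + of_real p * 0))\<^sup>2 - (cmod C)\<^sup>2"
    by (intro tendsto_intros summable_LIMSEQ suma e0)
  \<comment> \<open>Now \<open>e N\<close> tends to 0 and the energy identity is exact: the loss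
    \<open>(cmod C)\<^sup>2\<close> is the share of the kernel component of f.\<close>
  ultimately have "(1 - p\<^sup>2) * (\<Sum>n. (cmod (b n))\<^sup>2) = (1 - p\<^sup>2) * (\<Sum>n. (cmod (a n))\<^sup>2) + (cmod (0 + of_real p * 0))\<^sup>2 - (cmod C)\<^sup>2"
    unfolding tele by (rule LIMSEQ_unique)
  then have "(1 - p\<^sup>2) * (\<Sum>n. (cmod (b n))\<^sup>2) \<le> (1 - p\<^sup>2) * (\<Sum>n. (cmod (a n))\<^sup>2)"
    by simp
  then show "(hardy_norm ?g)\<^sup>2 \<le> (hardy_norm f)\<^sup>2"
    using p2 by (simp add: hardy_norm_power2[OF f] hardy_norm_power2[OF g2] a_def b_def)
qed

section \<open>Iterated quotients and finite Blaschke expansions\<close>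

fun blaschke_remainder :: "(nat \<Rightarrow> real) \<Rightarrow> nat \<Rightarrow> (complex \<Rightarrow> complex) \<Rightarrow> complex \<Rightarrow> complex" where
  "blaschke_remainder p 0 f = f"
| "blaschke_remainder p (Suc k) f = blaschke_quotient (p k) (blaschke_remainder p k f)"

definition blaschke_product :: "(nat \<Rightarrow> real) \<Rightarrow> nat \<Rightarrow> complex \<Rightarrow> complex" where
  "blaschke_product p k z = (\<Prod>i<k. blaschke_factor (p i) z)"

context
  fixes p :: "nat \<Rightarrow> real"
  assumes p: "\<And>i. \<bar>p i\<bar> < 1"
begin

lemma blaschke_product_le_1: "cmod z < 1 \<Longrightarrow> cmod (blaschke_product p k z) \<le> 1"
  unfolding blaschke_product_def prod_norm[symmetric]
  by (intro prod_le_1) (auto intro: blaschke_factor_le_1 p)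

lemma blaschke_product_holomorphic: "blaschke_product p k holomorphic_on ball 0 1"
  unfolding blaschke_product_def[abs_def]
  by (intro holomorphic_on_prod blaschke_factor_holomorphic p)

lemma blaschke_remainder_hardy:
  assumes "f \<in> hardy2"
  shows "blaschke_remainder p k f \<in> hardy2"
    and "(hardy_norm (blaschke_remainder p k f))\<^sup>2 \<le> (hardy_norm f)\<^sup>2"
proof -
  have "blaschke_remainder p k f \<in> hardy2 \<and> (hardy_norm (blaschke_remainder p k f))\<^sup>2 \<le> (hardy_norm f)\<^sup>2"
  proof (induction k)
    case 0
    show ?case using assms by simp
  next
    case (Suc k)
    then show ?case
      using blaschke_quotient_hardy[OF p[of k], of "blaschke_remainder p k f"]
      unfolding blaschke_remainder.simps by (blast intro: order_trans)
  qed
  then show "blaschke_remainder p k f \<in> hardy2"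
    and "(hardy_norm (blaschke_remainder p k f))\<^sup>2 \<le> (hardy_norm f)\<^sup>2" by auto
qed

text \<open>Together with the next two lemmas this provides the clauses of
  \<open>hardy_linear_op\<close> for the approximants; each is an induction in which both sides
  solve the same quotient equation.\<close>

lemma blaschke_remainder_cong:
  assumes "f \<in> hardy2" "g \<in> hardy2" "\<And>z. cmod z < 1 \<Longrightarrow> f z = g z" "cmod z < 1"
  shows "blaschke_remainder p k f z = blaschke_remainder p k g z"
  using assms(4)
proof (induction k arbitrary: z)
  case 0
  then show ?case using assms by simp
next
  case (Suc k)
  have pk: "cmod (of_real (p k)) < 1" using p[of k] by simp
  have hol: "blaschke_remainder p k f holomorphic_on ball 0 1" "blaschke_remainder p k g holomorphic_on ball 0 1"
    using assms by (auto intro: hardy2_holomorphic blaschke_remainder_hardy)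
  have "blaschke_quotient (p k) (blaschke_remainder p k f) z = blaschke_quotient (p k) (blaschke_remainder p k g) z"
    by (rule blaschke_quotient_unique[OF p hol(1) blaschke_quotient_holomorphic[OF hol(2)] _ Suc.prems])
      (simp add: blaschke_quotient_eq Suc.IH Suc.IH[OF pk])
  then show ?case by simp
qed

lemma blaschke_remainder_add:
  assumes "f \<in> hardy2" "g \<in> hardy2" "(\<lambda>z. f z + g z) \<in> hardy2" "cmod z < 1"
  shows "blaschke_remainder p k (\<lambda>z. f z + g z) z = blaschke_remainder p k f z + blaschke_remainder p k g z"
  using assms(4)
proof (induction k arbitrary: z)
  case (Suc k)
  have pk: "cmod (of_real (p k)) < 1" using p[of k] by simp
  let ?L = "blaschke_remainder p k"
  have hol: "?L f holomorphic_on ball 0 1" "?L g holomorphic_on ball 0 1"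
      "?L (\<lambda>z. f z + g z) holomorphic_on ball 0 1"
    using assms by (auto intro: hardy2_holomorphic blaschke_remainder_hardy)
  have "blaschke_quotient (p k) (?L (\<lambda>z. f z + g z)) z =
      blaschke_quotient (p k) (?L f) z + blaschke_quotient (p k) (?L g) z"
    by (rule blaschke_quotient_unique[OF p hol(3) _ _ Suc.prems])
      (intro holomorphic_on_add blaschke_quotient_holomorphic hol,
       simp add: distrib_left blaschke_quotient_eq Suc.IH Suc.IH[OF pk])
  then show ?case by simp
qed simp

lemma blaschke_remainder_cmult:
  assumes "f \<in> hardy2" "cmod z < 1"
  shows "blaschke_remainder p k (\<lambda>z. c * f z) z = c * blaschke_remainder p k f z"
  using assms(2)
proof (induction k arbitrary: z)
  case (Suc k)
  have pk: "cmod (of_real (p k)) < 1" using p[of k] by simp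
  let ?L = "blaschke_remainder p k f"
  have "blaschke_quotient (p k) (blaschke_remainder p k (\<lambda>z. c * f z)) z = c * blaschke_quotient (p k) ?L z"
  proof (rule blaschke_quotient_unique[OF p _ _ _ Suc.prems])
    show "blaschke_remainder p k (\<lambda>z. c * f z) holomorphic_on ball 0 1"
      by (intro hardy2_holomorphic blaschke_remainder_hardy hardy2_cmult assms)
    show "(\<lambda>z. c * blaschke_quotient (p k) ?L z) holomorphic_on ball 0 1"
      by (intro holomorphic_intros blaschke_quotient_holomorphic hardy2_holomorphic blaschke_remainder_hardy assms)
    fix z :: complex assume z: "cmod z < 1"
    have "(z - of_real (p k)) * (c * blaschke_quotient (p k) ?L z) =
        c * ((z - of_real (p k)) * blaschke_quotient (p k) ?L z)" by simp
    also have "\<dots> = (1 - of_real (p k) * z) * (c * ?L z) - (1 - of_real ((p k)\<^sup>2)) * (c * ?L (of_real (p k)))"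
      unfolding blaschke_quotient_eq by (simp add: algebra_simps)
    finally show "(z - of_real (p k)) * (c * blaschke_quotient (p k) ?L z) =
        (1 - of_real (p k) * z) * blaschke_remainder p k (\<lambda>z. c * f z) z -
        (1 - of_real ((p k)\<^sup>2)) * blaschke_remainder p k (\<lambda>z. c * f z) (of_real (p k))"
      using Suc.IH[OF z] Suc.IH[OF pk] by simp
  qed
  then show ?case by simp
qed simp

text \<open>Iterating the one-step decomposition telescopes. The functions on the right form, up to
  normalisation, the Takenaka-Malmquist system of the zeros, so the right side has rank at most k as
  a map of f.\<close>

lemma blaschke_expansion:
  assumes "cmod z < 1"
  shows "f z - blaschke_product p k z * blaschke_remainder p k f z =
    (\<Sum>i<k. ((1 - of_real ((p i)\<^sup>2)) * blaschke_remainder p i f (of_real (p i))) *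
       (blaschke_product p i z / (1 - of_real (p i) * z)))"
proof (induction k)
  case 0
  show ?case by (simp add: blaschke_product_def)
next
  case (Suc k)
  let ?L = "blaschke_remainder p k f" and ?q = "1 - of_real (p k) * z"
  have q: "?q \<noteq> 0" by (rule one_minus_mult_nonzero(2)[OF p assms])
  have "blaschke_factor (p k) z * blaschke_quotient (p k) ?L z =
      ((z - of_real (p k)) * blaschke_quotient (p k) ?L z) / ?q"
    by (simp add: blaschke_factor_def)
  also have "\<dots> = ?L z - (1 - of_real ((p k)\<^sup>2)) * ?L (of_real (p k)) / ?q"
    unfolding blaschke_quotient_eq using q by (simp add: diff_divide_distrib)
  finally have "blaschke_product p k z * (blaschke_factor (p k) z * blaschke_quotient (p k) ?L z) =
      blaschke_product p k z * (?L z - (1 - of_real ((p k)\<^sup>2)) * ?L (of_real (p k)) / ?q)" by simp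
  moreover have "blaschke_product p (Suc k) z * blaschke_remainder p (Suc k) f z =
      blaschke_product p k z * (blaschke_factor (p k) z * blaschke_quotient (p k) ?L z)"
    by (simp add: blaschke_product_def)
  ultimately show ?case
    unfolding sum.lessThan_Suc Suc[symmetric] by (simp add: right_diff_distrib)
qed

end

section \<open>Singular numbers of the composition operator\<close>

lemma hardy2_zero: "(\<lambda>z. 0) \<in> hardy2" "hardy_norm (\<lambda>z. 0) = 0"
proof -
  have "taylor_coeff (\<lambda>z. 0) n = 0" for n
    using taylor_coeff_unique[OF has_fps_expansion_0] by simp
  then show "(\<lambda>z. 0) \<in> hardy2" "hardy_norm (\<lambda>z. 0) = 0"
    by (auto simp: hardy2_def hardy_norm_def)
qed

lemma hardy_op_norm_le:
  assumes "\<And>f. f \<in> hardy2 \<Longrightarrow> hardy_norm f \<le> 1 \<Longrightarrow> hardy_norm (T f) \<le> M"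
  shows "hardy_op_norm T \<le> M"
  unfolding hardy_op_norm_def
proof (rule cSup_least)
  have "hardy_norm (T (\<lambda>z. 0)) \<in> {hardy_norm (T f) |f. f \<in> hardy2 \<and> hardy_norm f \<le> 1}"
    using hardy2_zero by (intro CollectI exI[of _ "\<lambda>z. 0"]) auto
  then show "{hardy_norm (T f) |f. f \<in> hardy2 \<and> hardy_norm f \<le> 1} \<noteq> {}" by blast
qed (use assms in auto)

text \<open>The supremum is a real \<open>Sup\<close>, so it is informative only for a set bounded
  above; that bound is shown first, and then the zero function gives a nonnegative element.\<close>

lemma hardy_op_norm_diff_nonneg:
  assumes T: "bounded_hardy_op T" and R: "bounded_hardy_op R"
  shows "0 \<le> hardy_op_norm (\<lambda>f z. T f z - R f z)"
proof -
  let ?D = "\<lambda>f z. T f z - R f z"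
  obtain C C' where C: "\<And>f. f \<in> hardy2 \<Longrightarrow> hardy_norm (T f) \<le> C * hardy_norm f"
    "\<And>f. f \<in> hardy2 \<Longrightarrow> hardy_norm (R f) \<le> C' * hardy_norm f"
    using T R unfolding bounded_hardy_op_def by blast
  have mem: "T f \<in> hardy2" "R f \<in> hardy2" if "f \<in> hardy2" for f
    using T R that by (auto simp: bounded_hardy_op_def hardy_linear_op_def)
  have bound: "hardy_norm (S f) \<le> \<bar>K\<bar>"
    if "hardy_norm (S f) \<le> K * hardy_norm f" "f \<in> hardy2" "hardy_norm f \<le> 1"
    for S :: "(complex \<Rightarrow> complex) \<Rightarrow> complex \<Rightarrow> complex" and K f
  proof -
    have "K * hardy_norm f \<le> \<bar>K\<bar> * 1"
      using that by (intro mult_mono) auto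
    with that(1) show ?thesis by simp
  qed
  have le: "hardy_norm (?D f) \<le> sqrt (2 * C\<^sup>2 + 2 * C'\<^sup>2)" if f: "f \<in> hardy2" "hardy_norm f \<le> 1" for f
  proof (rule hardy_norm_le[OF hardy2_diff(1)[OF mem[OF f(1)]]])
    have "(hardy_norm (T f))\<^sup>2 \<le> C\<^sup>2" "(hardy_norm (R f))\<^sup>2 \<le> C'\<^sup>2"
      using power_mono[OF bound[of T f C, OF C(1)[OF f(1)] f] hardy_norm_nonneg[OF mem(1)[OF f(1)]], of 2]
        power_mono[OF bound[of R f C', OF C(2)[OF f(1)] f] hardy_norm_nonneg[OF mem(2)[OF f(1)]], of 2]
      by auto
    with hardy2_diff(2)[OF mem[OF f(1)]]
    show "(hardy_norm (?D f))\<^sup>2 \<le> 2 * C\<^sup>2 + 2 * C'\<^sup>2" by linarith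
  qed
  have "hardy_norm (?D (\<lambda>z. 0)) \<le> hardy_op_norm ?D"
    unfolding hardy_op_norm_def
  proof (rule cSup_upper)
    show "bdd_above {hardy_norm (?D f) |f. f \<in> hardy2 \<and> hardy_norm f \<le> 1}"
      using le by (intro bdd_aboveI[of _ "sqrt (2 * C\<^sup>2 + 2 * C'\<^sup>2)"]) auto
    show "hardy_norm (?D (\<lambda>z. 0)) \<in> {hardy_norm (?D f) |f. f \<in> hardy2 \<and> hardy_norm f \<le> 1}"
      using hardy2_zero by (intro CollectI exI[of _ "\<lambda>z. 0"]) auto
  qed
  moreover have "0 \<le> hardy_norm (?D (\<lambda>z. 0))"
    by (intro hardy_norm_nonneg hardy2_diff(1) mem hardy2_zero)
  ultimately show ?thesis by linarith
qed

lemma singular_number_nonneg: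
  assumes "bounded_hardy_op T"
  shows "0 \<le> singular_number (Suc n) T"
  unfolding singular_number_def
proof (rule cInf_greatest)
  have "rank_less (Suc n) (\<lambda>f z. 0)"
    unfolding rank_less_def by (intro exI[of _ "{}"]) auto
  moreover have "bounded_hardy_op (\<lambda>f z. 0)"
    by (auto simp: bounded_hardy_op_def hardy_linear_op_def hardy2_zero intro!: exI[of _ 0])
  ultimately show "{hardy_op_norm (\<lambda>f z. T f z - R f z) |R. bounded_hardy_op R \<and> rank_less (Suc n) R} \<noteq> {}"
    by blast
qed (use hardy_op_norm_diff_nonneg[OF assms] in auto)

lemma singular_number_le:
  assumes "bounded_hardy_op T" "bounded_hardy_op R" "rank_less n R"
  shows "singular_number n T \<le> hardy_op_norm (\<lambda>f z. T f z - R f z)"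
  unfolding singular_number_def
proof (rule cInf_lower)
  show "bdd_below {hardy_op_norm (\<lambda>f z. T f z - R f z) |R. bounded_hardy_op R \<and> rank_less n R}"
    using hardy_op_norm_diff_nonneg[OF assms(1)] by (intro bdd_belowI[of _ 0]) auto
qed (use assms in blast)

text \<open>\<open>rank_less\<close> counts a set of functions while the expansion is an indexed
  family with possible repetitions, so the coefficients of equal functions are collected.\<close>

lemma rank_less_if_sum:
  assumes "k < n" "\<And>i. i < k \<Longrightarrow> E i \<in> hardy2"
    and "\<And>f. f \<in> hardy2 \<Longrightarrow> \<exists>c. \<forall>z\<in>ball 0 1. R f z = (\<Sum>i<k. c i * E i z)"
  shows "rank_less n R"
  unfolding rank_less_def
proof (intro exI[of _ "E ` {..<k}"] conjI ballI)
  show "card (E ` {..<k}) < n"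
    using card_image_le[of "{..<k}" E] assms(1) by simp
  fix f assume "f \<in> hardy2"
  then obtain c where c: "\<And>z. z \<in> ball 0 1 \<Longrightarrow> R f z = (\<Sum>i<k. c i * E i z)"
    using assms(3) by blast
  show "\<exists>c. \<forall>z\<in>ball 0 1. R f z = (\<Sum>g\<in>E ` {..<k}. c g * g z)"
  proof (intro exI ballI)
    fix z :: complex assume "z \<in> ball 0 1"
    then have "R f z = (\<Sum>i<k. c i * E i z)" by (rule c)
    also have "\<dots> = (\<Sum>g\<in>E ` {..<k}. \<Sum>i | i \<in> {..<k} \<and> E i = g. c i * E i z)"
      by (rule sum.image_gen) simp
    also have "\<dots> = (\<Sum>g\<in>E ` {..<k}. (\<Sum>i | i \<in> {..<k} \<and> E i = g. c i) * g z)"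
      by (intro sum.cong refl) (auto simp: sum_distrib_right)
    finally show "R f z = (\<Sum>g\<in>E ` {..<k}. (\<lambda>g. \<Sum>i | i \<in> {..<k} \<and> E i = g. c i) g * g z)" .
  qed
qed (use assms(2) in auto)

text \<open>The index is the floor of log 2 s shifted by m; it runs through 0 to 2m, which is the
  source of the 2m + 1 scales.\<close>

lemma floor_dyadic_scale:
  fixes s :: real and m :: nat
  assumes "2 powr (- real m) \<le> s" "s \<le> 2 powr real m"
  obtains j where "j < 2 * m + 1" "2 powr (real j - real m) \<le> s" "s \<le> 2 * 2 powr (real j - real m)"
proof -
  have s: "0 < s" using assms(1) by (rule order.strict_trans2[rotated]) simp
  define i where "i = \<lfloor>log 2 s\<rfloor>"
  have "- real m \<le> log 2 s" "log 2 s \<le> real m"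
    using assms s by (auto simp: le_log_iff log_le_iff)
  then have i: "- int m \<le> i" "i \<le> int m"
    unfolding i_def by linarith+
  define j where "j = nat (i + int m)"
  have j: "real j - real m = of_int i" using i by (simp add: j_def)
  have "2 powr of_int i \<le> s"
    using s by (simp add: le_log_iff[symmetric] i_def)
  moreover have "s \<le> 2 powr (of_int i + 1)"
    using s by (simp add: log_le_iff[symmetric] i_def)
  ultimately show ?thesis
    using i by (intro that[of j]) (auto simp: j, auto simp: j_def powr_add)
qed

section \<open>Finite rank approximation of the unweighted operator\<close>

context
  fixes \<theta> :: real
  assumes \<theta>: "0 < \<theta>" "\<theta> < 1"
begin

text \<open>Composition with the lens map turns growth of order 1/(1 - |z|^2) into a majorant with
  exponent -\<theta>, integrable since \<theta> < 1. Hence h itself need not lie in the Hardy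
  space.\<close>

lemma comp_lens_hardy:
  assumes hol: "h holomorphic_on ball 0 1" and A: "0 \<le> A"
    and h: "\<And>z. cmod z < 1 \<Longrightarrow> (cmod (h z))\<^sup>2 \<le> A / (1 - (cmod z)\<^sup>2)"
  shows "(\<lambda>z. h (lens_map \<theta> z)) \<in> hardy2"
    and "(hardy_norm (\<lambda>z. h (lens_map \<theta> z)))\<^sup>2 \<le> 8 / (1 - \<theta>) * (A * 2 / cos (\<theta> * pi / 2))"
proof -
  have "0 \<le> A * 2 / cos (\<theta> * pi / 2)"
    using A lens_power_sector(3)[OF \<theta>, of 0] by simp
  note * = hardy2_if_sin_majorant[OF \<theta> this comp_lens_map_holomorphic[OF \<theta> hol]
      comp_lens_map_polar_bound[OF \<theta> _ _ _ h A]]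
  show "(\<lambda>z. h (lens_map \<theta> z)) \<in> hardy2" by (rule *(1))
  show "(hardy_norm (\<lambda>z. h (lens_map \<theta> z)))\<^sup>2 \<le> 8 / (1 - \<theta>) * (A * 2 / cos (\<theta> * pi / 2))"
    by (rule *(2))
qed

lemma composition_bounded: "bounded_hardy_op (\<lambda>f z. f (lens_map \<theta> z))"
proof (rule bounded_hardy_op_if_power2)
  show "hardy_linear_op (\<lambda>f z. f (lens_map \<theta> z))"
    unfolding hardy_linear_op_def
    using lens_map_in_disk[OF \<theta>] hardy2_point_evaluation hardy2_holomorphic
    by (auto intro!: comp_lens_hardy(1)[where A = "(hardy_norm _)\<^sup>2"])
  show "0 \<le> 8 / (1 - \<theta>) * (2 / cos (\<theta> * pi / 2))"
    using \<theta> lens_power_sector(3)[OF \<theta>, of 0] by simp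
  fix f assume f: "f \<in> hardy2"
  show "(hardy_norm (\<lambda>z. f (lens_map \<theta> z)))\<^sup>2 \<le> 8 / (1 - \<theta>) * (2 / cos (\<theta> * pi / 2)) * (hardy_norm f)\<^sup>2"
    using comp_lens_hardy(2)[OF hardy2_holomorphic[OF f] zero_le_power2 hardy2_point_evaluation[OF f]]
    by (simp add: mult_ac)
qed

text \<open>In the half-plane coordinate the factor becomes (S - P)/(S + P). In a sector and with
  |S| comparable to P, the term 2 P Re S is a fixed proportion of |S|^2 + P^2, which keeps the
  quotient below 1.\<close>

lemma dyadic_blaschke_factor_bound:
  assumes z: "cmod z < 1" and P: "0 < P" "P \<le> cmod (lens_power \<theta> z)" "cmod (lens_power \<theta> z) \<le> 2 * P"
  defines "c \<equiv> 4 / 5 * cos (\<theta> * pi / 2)"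
  shows "(cmod (blaschke_factor ((P - 1) / (P + 1)) (lens_map \<theta> z)))\<^sup>2 \<le> (1 - c) / (1 + c)"
proof -
  define S where "S = lens_power \<theta> z"
  define s where "s = cmod S"
  define p where "p = (P - 1) / (P + 1)"
  have c: "0 < c" using lens_power_sector(3)[OF \<theta>, of 0] by (simp add: c_def)
  have R: "cos (\<theta> * pi / 2) * s \<le> Re S" "0 < Re S"
    using lens_power_sector[OF \<theta> z] by (auto simp: S_def s_def)
  have S1: "S + 1 \<noteq> 0" using lens_power_plus_1_nonzero[OF \<theta> z] by (simp add: S_def)
  have P1: "complex_of_real P + 1 \<noteq> 0"
    using P(1) by (metis of_real_1 of_real_add of_real_eq_0_iff add_pos_pos zero_less_one less_irrefl)
  have SP: "S + of_real P \<noteq> 0"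
  proof
    assume "S + of_real P = 0"
    then have "Re S + P = 0" by (metis plus_complex.sel(1) Re_complex_of_real zero_complex.sel(1))
    with R P show False by linarith
  qed
  have l: "lens_map \<theta> z = (S - 1) / (S + 1)" using lens_map_eq[OF \<theta> z] by (simp add: S_def)
  have pc: "of_real p = (of_real P - 1) / (of_real P + (1::complex))" by (simp add: p_def)
  have num: "lens_map \<theta> z - of_real p = 2 * (S - of_real P) / ((S + 1) * (of_real P + 1))"
    unfolding l pc using S1 P1 by (simp add: divide_simps) (simp add: algebra_simps)
  have den: "1 - of_real p * lens_map \<theta> z = 2 * (S + of_real P) / ((S + 1) * (of_real P + 1))"
    unfolding l pc using S1 P1 by (simp add: divide_simps) (simp add: algebra_simps)
  have bf: "blaschke_factor p (lens_map \<theta> z) = (S - of_real P) / (S + of_real P)"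
    unfolding blaschke_factor_def num den using S1 P1
    by (simp del: distrib_left_numeral right_diff_distrib_numeral)
  define M where "M = s\<^sup>2 + P\<^sup>2"
  have n1: "(cmod (S - of_real P))\<^sup>2 = M - 2 * P * Re S" "(cmod (S + of_real P))\<^sup>2 = M + 2 * P * Re S"
    unfolding M_def s_def cmod_power2 by (auto simp: power2_eq_square algebra_simps)
  \<comment> \<open>Valid as P <= s <= 2P; expanding gives s^2 + P^2 <= (5/2) s P, whence the 4/5 in
    c.\<close>
  have "(s - P / 2) * (s - 2 * P) \<le> 0"
    using P by (intro mult_nonneg_nonpos) (auto simp: s_def S_def)
  then have "M \<le> 5 / 2 * (s * P)"
    by (simp add: M_def power2_eq_square algebra_simps)
  then have "c * M \<le> c * (5 / 2 * (s * P))" using c by (intro mult_left_mono) auto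
  also have "\<dots> = 2 * P * (cos (\<theta> * pi / 2) * s)" by (simp add: c_def)
  also have "\<dots> \<le> 2 * P * Re S" using R P by (intro mult_left_mono) auto
  finally have "(M - 2 * P * Re S) * (1 + c) \<le> (1 - c) * (M + 2 * P * Re S)"
    by (simp add: algebra_simps)
  moreover have "0 < M + 2 * P * Re S"
    using R P by (intro add_nonneg_pos) (auto simp: M_def)
  ultimately have "(M - 2 * P * Re S) / (M + 2 * P * Re S) \<le> (1 - c) / (1 + c)"
    using c by (simp add: divide_simps mult.commute)
  then show ?thesis
    by (simp add: bf[unfolded p_def] norm_divide power_divide n1)
qed

text \<open>The error operator is f -> (B L f) composed with \<lambda>. Its symbol B is small when
  |S| lies in the dyadic range, and elsewhere \<open>\<bar>sin t\<bar>\<close> is small enough for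
  part of the spare integrability to give the same rate.\<close>

lemma composition_approximation:
  "\<exists>K q. 0 \<le> K \<and> 0 < q \<and> q < 1 \<and> (\<forall>m n. (2 * m + 1) * m \<le> n \<longrightarrow>
      singular_number (Suc n) (\<lambda>f z. f (lens_map \<theta> z)) \<le> sqrt (K * q ^ m))"
proof -
  define c0 where "c0 = cos (\<theta> * pi / 2)"
  define c where "c = 4 / 5 * c0"
  \<comment> \<open>Half of the margin between \<theta> and 1 is spent on smallness; the other half
    keeps \<kappa> = \<theta> + \<eta> below 1, so the majorant stays integrable.\<close>
  define \<eta> where "\<eta> = (1 - \<theta>) / 2"
  define \<kappa> where "\<kappa> = (1 + \<theta>) / 2"
  \<comment> \<open>The first entry is the gain per matching Blaschke factor, the second the rate
    outside the dyadic range.\<close>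
  define q where "q = max ((1 - c) / (1 + c)) (2 powr (- \<eta> / \<theta>))"
  define K where "K = 8 / (1 - \<kappa>) * (4 / c0)"
  have c0: "0 < c0" "c0 \<le> 1"
    using lens_power_sector(3)[OF \<theta>, of 0] by (auto simp: c0_def)
  have c: "0 < c" "c < 1" using c0 by (auto simp: c_def)
  have \<eta>: "0 < \<eta>" "\<eta> < 1" using \<theta> by (auto simp: \<eta>_def)
  have \<kappa>: "0 < \<kappa>" "\<kappa> < 1" "\<kappa> = \<theta> + \<eta>" using \<theta> by (auto simp: \<kappa>_def \<eta>_def field_simps)
  have "2 powr (- \<eta> / \<theta>) < 2 powr (0::real)"
    using \<eta> \<theta> by (intro powr_less_mono) auto
  then have q: "0 < q" "q < 1"
    using c by (auto simp: q_def less_max_iff_disj)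
  have K: "0 \<le> K" using \<kappa> c0 by (simp add: K_def)
  have "singular_number (Suc n) (\<lambda>f z. f (lens_map \<theta> z)) \<le> sqrt (K * q ^ m)"
    if n: "(2 * m + 1) * m \<le> n" for m n
  proof -
    define l where "l = 2 * m + 1"
    define k where "k = m * l"
    \<comment> \<open>Reduction modulo l cycles through all scales, so k = m l zeros give every
      scale multiplicity m.\<close>
    define P where "P i = 2 powr (real (i mod l) - real m)" for i
    define p where "p i = (P i - 1) / (P i + 1)" for i
    have Ppos: "0 < P i" for i by (simp add: P_def)
    have p: "\<bar>p i\<bar> < 1" for i using Ppos[of i] by (auto simp: p_def abs_if field_simps)
    let ?B = "blaschke_product p k" and ?L = "blaschke_remainder p k"
    define R where "R f z = f (lens_map \<theta> z) - ?B (lens_map \<theta> z) * ?L f (lens_map \<theta> z)" for f z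
    have norm_R: "R f \<in> hardy2 \<and> (hardy_norm (R f))\<^sup>2 \<le> 8 / (1 - \<theta>) * (4 * 2 / c0) * (hardy_norm f)\<^sup>2"
      if f: "f \<in> hardy2" for f
    proof -
      let ?h = "\<lambda>z. f z - ?B z * ?L f z"
      have L: "?L f \<in> hardy2" "(hardy_norm (?L f))\<^sup>2 \<le> (hardy_norm f)\<^sup>2"
        by (intro blaschke_remainder_hardy p f)+
      have hol: "?h holomorphic_on ball 0 1"
        by (intro holomorphic_on_diff holomorphic_on_mult blaschke_product_holomorphic p hardy2_holomorphic L f)
      have A: "0 \<le> 4 * (hardy_norm f)\<^sup>2" by simp
      have le: "(cmod (?h z))\<^sup>2 \<le> 4 * (hardy_norm f)\<^sup>2 / (1 - (cmod z)\<^sup>2)" if z: "cmod z < 1" for z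
      proof -
        have z2: "0 < 1 - (cmod z)\<^sup>2" using z by (simp add: abs_square_less_1)
        have "cmod (?h z) \<le> cmod (f z) + cmod (?L f z)"
        proof -
          have "cmod (?B z * ?L f z) \<le> 1 * cmod (?L f z)"
            unfolding norm_mult by (intro mult_right_mono blaschke_product_le_1 p z) auto
          then show ?thesis using norm_triangle_ineq4[of "f z" "?B z * ?L f z"] by simp
        qed
        then have "(cmod (?h z))\<^sup>2 \<le> (cmod (f z) + cmod (?L f z))\<^sup>2"
          by (intro power_mono) auto
        also have "\<dots> \<le> 2 * (cmod (f z))\<^sup>2 + 2 * (cmod (?L f z))\<^sup>2"
          using sum_squares_bound[of "cmod (f z)" "cmod (?L f z)"] by (simp add: power2_sum)
        also have "\<dots> \<le> 2 * ((hardy_norm f)\<^sup>2 / (1 - (cmod z)\<^sup>2)) + 2 * ((hardy_norm f)\<^sup>2 / (1 - (cmod z)\<^sup>2))"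
        proof (intro add_mono mult_left_mono)
          show "(cmod (f z))\<^sup>2 \<le> (hardy_norm f)\<^sup>2 / (1 - (cmod z)\<^sup>2)"
            by (rule hardy2_point_evaluation[OF f z])
          have "(cmod (?L f z))\<^sup>2 \<le> (hardy_norm (?L f))\<^sup>2 / (1 - (cmod z)\<^sup>2)"
            by (rule hardy2_point_evaluation[OF L(1) z])
          also have "\<dots> \<le> (hardy_norm f)\<^sup>2 / (1 - (cmod z)\<^sup>2)"
            using L(2) z2 by (intro divide_right_mono) auto
          finally show "(cmod (?L f z))\<^sup>2 \<le> (hardy_norm f)\<^sup>2 / (1 - (cmod z)\<^sup>2)" .
        qed auto
        finally show ?thesis by simp
      qed
      show ?thesis
        using comp_lens_hardy[OF hol A le] by (simp add: R_def[abs_def] c0_def mult_ac)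
    qed
    have lin_R: "hardy_linear_op R"
      unfolding hardy_linear_op_def
    proof (intro conjI ballI allI impI)
      show "R f \<in> hardy2" if "f \<in> hardy2" for f using norm_R[OF that] by simp
    next
      fix f g z assume "f \<in> hardy2" "g \<in> hardy2" "\<forall>z\<in>ball 0 1. f z = g z" "z \<in> ball (0::complex) 1"
      then show "R f z = R g z"
        using blaschke_remainder_cong[OF p, where f = f and g = g and z = "lens_map \<theta> z" and k = k] lens_map_in_disk[OF \<theta>, of z]
        by (simp add: R_def)
    next
      fix f g z assume a: "f \<in> hardy2" "g \<in> hardy2" "z \<in> ball (0::complex) 1"
      have "(\<lambda>z. f z + g z) \<in> hardy2"
        using hardy2_diff(1)[OF a(1) hardy2_cmult(1)[OF a(2), of "-1"]] by simp
      with a show "R (\<lambda>x. f x + g x) z = R f z + R g z"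
        using blaschke_remainder_add[OF p, where f = f and g = g and z = "lens_map \<theta> z" and k = k] lens_map_in_disk[OF \<theta>, of z]
        by (simp add: R_def algebra_simps)
    next
      fix f c z assume "f \<in> hardy2" "z \<in> ball (0::complex) 1"
      then show "R (\<lambda>x. c * f x) z = c * R f z"
        using blaschke_remainder_cmult[OF p, where f = f and z = "lens_map \<theta> z" and k = k and c = c] lens_map_in_disk[OF \<theta>, of z]
        by (simp add: R_def algebra_simps)
    qed
    have R: "bounded_hardy_op R"
    proof (rule bounded_hardy_op_if_power2[OF lin_R])
      show "0 \<le> 8 / (1 - \<theta>) * (4 * 2 / c0)" using \<theta> c0 by simp
    qed (use norm_R in blast)
    have rank: "rank_less (Suc n) R"
    proof (rule rank_less_if_sum)
      show "k < Suc n" using n by (simp add: k_def l_def mult.commute)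
      show "(\<lambda>z. blaschke_product p i (lens_map \<theta> z) / (1 - of_real (p i) * lens_map \<theta> z)) \<in> hardy2" for i
      proof (rule comp_lens_hardy(1))
        show "(\<lambda>z. blaschke_product p i z / (1 - of_real (p i) * z)) holomorphic_on ball 0 1"
          using one_minus_mult_nonzero(2)[OF p]
          by (intro holomorphic_on_divide blaschke_product_holomorphic p holomorphic_intros) auto
        show "0 \<le> (1 / (1 - \<bar>p i\<bar>))\<^sup>2" by simp
        fix z :: complex assume z: "cmod z < 1"
        have z2: "0 < 1 - (cmod z)\<^sup>2" using z by (simp add: abs_square_less_1)
        have "cmod (blaschke_product p i z / (1 - of_real (p i) * z)) \<le> 1 / (1 - \<bar>p i\<bar>)"
          unfolding norm_divide using one_minus_mult_nonzero(1)[OF p z, of i] p[of i]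
          by (intro frac_le blaschke_product_le_1 p z) auto
        then have "(cmod (blaschke_product p i z / (1 - of_real (p i) * z)))\<^sup>2 \<le> (1 / (1 - \<bar>p i\<bar>))\<^sup>2"
          by (intro power_mono) auto
        also have "\<dots> \<le> (1 / (1 - \<bar>p i\<bar>))\<^sup>2 / (1 - (cmod z)\<^sup>2)"
          using z2 divide_left_mono[of "1 - (cmod z)\<^sup>2" 1 "(1 / (1 - \<bar>p i\<bar>))\<^sup>2"] by simp
        finally show "(cmod (blaschke_product p i z / (1 - of_real (p i) * z)))\<^sup>2
          \<le> (1 / (1 - \<bar>p i\<bar>))\<^sup>2 / (1 - (cmod z)\<^sup>2)" .
      qed
      fix f assume "f \<in> hardy2"
      show "\<exists>c. \<forall>z\<in>ball 0 1. R f z = (\<Sum>i<k. c i *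
          (blaschke_product p i (lens_map \<theta> z) / (1 - of_real (p i) * lens_map \<theta> z)))"
      proof (intro exI ballI)
        fix z :: complex assume "z \<in> ball 0 1"
        then show "R f z = (\<Sum>i<k. ((1 - of_real ((p i)\<^sup>2)) * blaschke_remainder p i f (of_real (p i))) *
          (blaschke_product p i (lens_map \<theta> z) / (1 - of_real (p i) * lens_map \<theta> z)))"
          unfolding R_def by (intro blaschke_expansion p lens_map_in_disk \<theta>) simp
      qed
    qed
    \<comment> \<open>The product is cut into m blocks of length l. Each block contains one factor
      whose scale matches |S|, contributing at most q, while the others are at most 1.\<close>
    have B_small: "(cmod (?B (lens_map \<theta> z)))\<^sup>2 \<le> q ^ m"
      if z: "cmod z < 1" and s: "2 powr (- real m) \<le> cmod (lens_power \<theta> z)" "cmod (lens_power \<theta> z) \<le> 2 powr real m" for z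
    proof -
      let ?b = "\<lambda>i. (cmod (blaschke_factor (p i) (lens_map \<theta> z)))\<^sup>2"
      have lz: "cmod (lens_map \<theta> z) < 1" by (rule lens_map_in_disk[OF \<theta> z])
      have b1: "0 \<le> ?b i" "?b i \<le> 1" for i
        using blaschke_factor_le_1[OF p lz, of i] by (auto simp: power_le_one)
      obtain j where j: "j < l" "2 powr (real j - real m) \<le> cmod (lens_power \<theta> z)"
          "cmod (lens_power \<theta> z) \<le> 2 * 2 powr (real j - real m)"
        using floor_dyadic_scale[OF s] unfolding l_def by blast
      have bj: "?b (i * l + j) \<le> q" for i
      proof -
        have "P (i * l + j) = 2 powr (real j - real m)" using j(1) by (simp add: P_def)
        then have "?b (i * l + j) \<le> (1 - c) / (1 + c)"
          unfolding p_def c_def c0_def using j Ppos[of "i * l + j"]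
          by (intro dyadic_blaschke_factor_bound z) auto
        then show ?thesis by (simp add: q_def)
      qed
      have "(cmod (?B (lens_map \<theta> z)))\<^sup>2 = (\<Prod>i<k. ?b i)"
        by (simp add: blaschke_product_def prod_norm[symmetric] prod_power_distrib)
      also have "\<dots> = (\<Prod>i<m. prod ?b {i * l..<i * l + l})"
        unfolding k_def by (rule prod.nat_group[symmetric])
      also have "\<dots> \<le> (\<Prod>i<m. q)"
      proof (intro prod_mono conjI prod_nonneg ballI b1)
        fix i
        have "prod ?b {i * l..<i * l + l} = ?b (i * l + j) * prod ?b ({i * l..<i * l + l} - {i * l + j})"
          using j(1) by (intro prod.remove) auto
        also have "\<dots> \<le> q * 1"
          using q b1 by (intro mult_mono bj prod_le_1 prod_nonneg) auto
        finally show "prod ?b {i * l..<i * l + l} \<le> q" by simp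
      qed
      finally show ?thesis by simp
    qed
    have "hardy_op_norm (\<lambda>f z. f (lens_map \<theta> z) - R f z) \<le> sqrt (K * q ^ m)"
    proof (rule hardy_op_norm_le)
      fix f assume f: "f \<in> hardy2" "hardy_norm f \<le> 1"
      have f1: "(hardy_norm f)\<^sup>2 \<le> 1" using f by (simp add: power_le_one)
      have L: "?L f \<in> hardy2" "(hardy_norm (?L f))\<^sup>2 \<le> (hardy_norm f)\<^sup>2"
        by (intro blaschke_remainder_hardy p f)+
      have Lz: "(cmod (?L f z))\<^sup>2 \<le> 1 / (1 - (cmod z)\<^sup>2)" if z: "cmod z < 1" for z
      proof -
        have z2: "0 < 1 - (cmod z)\<^sup>2" using z by (simp add: abs_square_less_1)
        have "(cmod (?L f z))\<^sup>2 \<le> (hardy_norm (?L f))\<^sup>2 / (1 - (cmod z)\<^sup>2)"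
          by (rule hardy2_point_evaluation[OF L(1) z])
        also have "\<dots> \<le> 1 / (1 - (cmod z)\<^sup>2)"
          using L(2) f1 z2 by (intro divide_right_mono) auto
        finally show ?thesis .
      qed
      let ?F = "\<lambda>z. ?B (lens_map \<theta> z) * ?L f (lens_map \<theta> z)"
      have hol: "?F holomorphic_on ball 0 1"
        by (intro holomorphic_on_mult comp_lens_map_holomorphic[OF \<theta>] blaschke_product_holomorphic p hardy2_holomorphic L)
      have A: "0 \<le> 4 / c0 * q ^ m" using c0 q by simp
      have le: "(cmod (?F (of_real r * cis t)))\<^sup>2 \<le> 4 / c0 * q ^ m * \<bar>sin t\<bar> powr (- \<kappa>)"
        if r: "0 < r" "r < 1" and t: "sin t \<noteq> 0" for r t
      proof -
        let ?z = "of_real r * cis t"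
        define u where "u = \<bar>sin t\<bar>"
        have u: "0 < u" "u \<le> 1" using t by (auto simp: u_def)
        have z: "cmod ?z < 1" by (rule norm_rcis_lt_1[OF r])
        define x where "x = (u / 2) powr \<theta>"
        have x: "0 < x" using u by (simp add: x_def)
        have xi: "(2 / u) powr \<theta> = 1 / x" using u by (simp add: x_def powr_divide)
        have Lb: "(cmod (?L f (lens_map \<theta> ?z)))\<^sup>2 \<le> 2 / c0 * u powr (- \<theta>)"
          using comp_lens_map_polar_bound[OF \<theta> r t Lz] by (simp add: c0_def u_def)
        have split: "u powr (- \<theta>) = u powr \<eta> * u powr (- \<kappa>)"
          by (simp add: \<kappa>(3) powr_add[symmetric])
        \<comment> \<open>Either x and 1/x enclose |S| within the dyadic range and B is small, or x
          < 2^(-m) and the factor \<open>u powr \<eta>\<close> is itself of order q^m.\<close>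
        have "(cmod (?B (lens_map \<theta> ?z)))\<^sup>2 * u powr \<eta> \<le> 2 * q ^ m"
        proof (cases "2 powr (- real m) \<le> x")
          case True
          have "1 / x \<le> 1 / 2 powr (- real m)" using True x by (intro divide_left_mono) auto
          then have "1 / x \<le> 2 powr real m" by (simp add: powr_minus_divide)
          with lens_power_polar_bounds[OF \<theta> r t] True xi
          have "(cmod (?B (lens_map \<theta> ?z)))\<^sup>2 \<le> q ^ m"
            by (intro B_small z) (auto simp: x_def u_def)
          moreover have "u powr \<eta> \<le> 1" using u \<eta> by (intro powr_le1) auto
          ultimately have "(cmod (?B (lens_map \<theta> ?z)))\<^sup>2 * u powr \<eta> \<le> q ^ m * 1"
            using q by (intro mult_mono) auto
          then show ?thesis using q by (smt (verit) zero_le_power)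
        next
          case False
          have "(u / 2) powr \<eta> = x powr (\<eta> / \<theta>)"
            using \<theta> by (simp add: x_def powr_powr)
          also have "\<dots> \<le> (2 powr (- real m)) powr (\<eta> / \<theta>)"
            using False x \<eta> \<theta> by (intro powr_mono2) auto
          also have "\<dots> = (2 powr (- \<eta> / \<theta>)) ^ m"
            by (simp add: powr_powr powr_realpow[symmetric] mult.commute)
          also have "\<dots> \<le> q ^ m" by (intro power_mono) (auto simp: q_def)
          finally have "(u / 2) powr \<eta> \<le> q ^ m" .
          moreover have "u powr \<eta> = 2 powr \<eta> * (u / 2) powr \<eta>"
            using u by (simp add: powr_divide)
          moreover have "2 powr \<eta> \<le> (2::real)" using powr_mono[of \<eta> 1 "2::real"] \<eta> by simp
          ultimately have "u powr \<eta> \<le> 2 * q ^ m"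
            using q by (auto intro!: mult_mono)
          moreover have "(cmod (?B (lens_map \<theta> ?z)))\<^sup>2 \<le> 1"
            using blaschke_product_le_1[OF p lens_map_in_disk[OF \<theta> z], where k = k]
            by (simp add: power_le_one)
          ultimately have "(cmod (?B (lens_map \<theta> ?z)))\<^sup>2 * u powr \<eta> \<le> 1 * (2 * q ^ m)"
            by (intro mult_mono) auto
          then show ?thesis by simp
        qed
        then have "(2 / c0 * u powr (- \<kappa>)) * ((cmod (?B (lens_map \<theta> ?z)))\<^sup>2 * u powr \<eta>)
            \<le> (2 / c0 * u powr (- \<kappa>)) * (2 * q ^ m)"
          using c0 by (intro mult_left_mono) auto
        moreover have "(cmod (?F ?z))\<^sup>2 \<le> (cmod (?B (lens_map \<theta> ?z)))\<^sup>2 * (2 / c0 * u powr (- \<theta>))"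
          unfolding norm_mult power_mult_distrib by (intro mult_left_mono Lb) auto
        ultimately show ?thesis
          unfolding split by (simp add: u_def mult_ac)
      qed
      note maj = hardy2_if_sin_majorant[OF \<kappa>(1,2) A hol le]
      have "hardy_norm ?F \<le> sqrt (K * q ^ m)"
        by (rule hardy_norm_le) (use maj in \<open>auto simp: K_def mult.assoc\<close>)
      then show "hardy_norm (\<lambda>z. f (lens_map \<theta> z) - R f z) \<le> sqrt (K * q ^ m)"
        by (simp add: R_def)
    qed
    with singular_number_le[OF composition_bounded R rank] show ?thesis by linarith
  qed
  with K q show ?thesis by blast
qed

end

section \<open>Compactness and Schatten membership of the unweighted operator\<close>

lemma compact_subset_cball:
  assumes "compact K" "K \<subseteq> ball (0::complex) 1"
  obtains \<rho> where "0 \<le> \<rho>" "\<rho> < 1" "K \<subseteq> cball 0 \<rho>"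
proof (cases "K = {}")
  case True
  then show ?thesis by (intro that[of 0]) auto
next
  case False
  have "continuous_on K cmod" by (intro continuous_intros)
  from continuous_attains_sup[OF assms(1) False this]
  obtain x where "x \<in> K" "\<forall>y\<in>K. cmod y \<le> cmod x" by blast
  with assms(2) show ?thesis by (intro that[of "cmod x"]) auto
qed

lemma summable_exp_minus_sqrt:
  assumes "0 < (c::real)"
  shows "summable (\<lambda>n. exp (- c * (sqrt (real n / 3) - 1)))"
proof (rule summable_comparison_test_bigo)
  show "summable (\<lambda>n. norm (1 / real n ^ 2))"
    using inverse_power_summable[of 2, where 'a = real] by (simp add: inverse_eq_divide)
  show "(\<lambda>n. exp (- c * (sqrt (real n / 3) - 1))) \<in> O(\<lambda>n. 1 / real n ^ 2)"
    using assms by real_asymp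
qed

context
  fixes \<theta> :: real
  assumes \<theta>: "0 < \<theta>" "\<theta> < 1"
begin

text \<open>Montel's theorem yields a locally uniform limit g, which inherits the growth bound; that
  suffices for g composed with \<lambda> to lie in the Hardy space. Norm convergence splits the
  circle: away from the zeros of \<open>sin\<close> the lens image stays in a fixed compact disk,
  and near them the spare exponent \<eta> gives smallness.\<close>

lemma composition_compact: "compact_hardy_op (\<lambda>f z. f (lens_map \<theta> z))"
  unfolding compact_hardy_op_def
proof (intro conjI allI impI composition_bounded[OF \<theta>])
  fix f :: "nat \<Rightarrow> complex \<Rightarrow> complex"
  assume f: "\<forall>n. f n \<in> hardy2 \<and> hardy_norm (f n) \<le> 1"
  have f_le: "(cmod (f n z))\<^sup>2 \<le> 1 / (1 - (cmod z)\<^sup>2)" if z: "cmod z < 1" for n z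
  proof -
    have "0 < 1 - (cmod z)\<^sup>2" using z by (simp add: abs_square_less_1)
    moreover have "(hardy_norm (f n))\<^sup>2 \<le> 1" using f by (simp add: power_le_one)
    ultimately show ?thesis
      using hardy2_point_evaluation[OF _ z, of "f n"] f
      by (meson divide_right_mono less_imp_le order_trans)
  qed
  have bnd: "\<exists>B. \<forall>h\<in>range f. \<forall>z\<in>K. cmod (h z) \<le> B" if K: "compact K" "K \<subseteq> ball 0 1" for K
  proof -
    obtain \<rho> where \<rho>: "0 \<le> \<rho>" "\<rho> < 1" "K \<subseteq> cball 0 \<rho>"
      using compact_subset_cball[OF K] .
    have "cmod (f n z) \<le> sqrt (1 / (1 - \<rho>\<^sup>2))" if "z \<in> K" for n z
    proof (rule real_le_rsqrt)
      have z: "cmod z \<le> \<rho>" "cmod z < 1" using that \<rho> by auto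
      have "(cmod z)\<^sup>2 \<le> \<rho>\<^sup>2" "\<rho>\<^sup>2 < 1"
        using z \<rho> by (auto intro: power_mono simp: abs_square_less_1)
      then have "1 / (1 - (cmod z)\<^sup>2) \<le> 1 / (1 - \<rho>\<^sup>2)" by (intro divide_left_mono) auto
      with f_le[OF z(2), of n] show "(cmod (f n z))\<^sup>2 \<le> 1 / (1 - \<rho>\<^sup>2)" by linarith
    qed
    then show ?thesis by blast
  qed
  have hol: "h holomorphic_on ball 0 1" if "h \<in> range f" for h
    using that f by (auto dest: hardy2_holomorphic)
  obtain g r where g: "g holomorphic_on ball 0 1" "strict_mono (r :: nat \<Rightarrow> nat)"
      "\<And>x. x \<in> ball 0 1 \<Longrightarrow> (\<lambda>n. f (r n) x) \<longlonglongrightarrow> g x"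
      "\<And>K. \<lbrakk>compact K; K \<subseteq> ball 0 1\<rbrakk> \<Longrightarrow> uniform_limit K (f \<circ> r) g sequentially"
    using Montel[OF open_ball hol bnd subset_refl] by metis
  have g_le: "(cmod (g z))\<^sup>2 \<le> 1 / (1 - (cmod z)\<^sup>2)" if z: "cmod z < 1" for z
  proof (rule LIMSEQ_le_const2)
    show "(\<lambda>n. (cmod (f (r n) z))\<^sup>2) \<longlonglongrightarrow> (cmod (g z))\<^sup>2"
      using z by (intro tendsto_intros g(3)) auto
  qed (use f_le[OF z] in auto)
  have d_le: "(cmod (f n z - g z))\<^sup>2 \<le> 4 / (1 - (cmod z)\<^sup>2)" if z: "cmod z < 1" for n z
  proof -
    have "(cmod (f n z - g z))\<^sup>2 \<le> (cmod (f n z) + cmod (g z))\<^sup>2"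
      by (intro power_mono norm_triangle_ineq4) auto
    also have "\<dots> \<le> 2 * (cmod (f n z))\<^sup>2 + 2 * (cmod (g z))\<^sup>2"
      using sum_squares_bound[of "cmod (f n z)" "cmod (g z)"] by (simp add: power2_sum)
    finally show ?thesis using f_le[OF z, of n] g_le[OF z] by simp
  qed
  define c0 where "c0 = cos (\<theta> * pi / 2)"
  define \<eta> where "\<eta> = (1 - \<theta>) / 2"
  define \<kappa> where "\<kappa> = (1 + \<theta>) / 2"
  have c0: "0 < c0" using lens_power_sector(3)[OF \<theta>, of 0] by (simp add: c0_def)
  have \<eta>: "0 < \<eta>" using \<theta> by (simp add: \<eta>_def)
  have \<kappa>: "0 < \<kappa>" "\<kappa> < 1" "\<kappa> = \<theta> + \<eta>" using \<theta> by (auto simp: \<kappa>_def \<eta>_def field_simps)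
  define D where "D k z = f (r k) (lens_map \<theta> z) - g (lens_map \<theta> z)" for k z
  have holD: "D k holomorphic_on ball 0 1" for k
    unfolding D_def[abs_def] using f
    by (intro holomorphic_on_diff comp_lens_map_holomorphic[OF \<theta>] g hardy2_holomorphic) auto
  have D_le: "(cmod (D k (of_real \<rho> * cis t)))\<^sup>2 \<le> 8 / c0 * \<bar>sin t\<bar> powr (- \<theta>)"
    if "0 < \<rho>" "\<rho> < 1" "sin t \<noteq> 0" for k \<rho> t
    using comp_lens_map_polar_bound[OF \<theta> that d_le[where n = "r k"]] by (simp add: D_def c0_def)
  have G: "(\<lambda>z. g (lens_map \<theta> z)) \<in> hardy2"
    by (rule comp_lens_hardy(1)[OF \<theta> g(1) zero_le_one g_le])
  have "(\<lambda>k. hardy_norm (D k)) \<longlonglongrightarrow> 0"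
  proof (rule LIMSEQ_I)
    fix \<epsilon> :: real assume \<epsilon>: "0 < \<epsilon>"
    \<comment> \<open>The choices fit backwards: e makes the final bound
      \<open>\<epsilon>\<^sup>2 / 2\<close>, \<delta> makes
      \<open>8 / c0 * \<delta> powr \<eta>\<close> equal to e, and R bounds the lens image where
      \<open>\<bar>sin t\<bar>\<close> is at least \<delta>.\<close>
    define e where "e = \<epsilon>\<^sup>2 * (1 - \<kappa>) / 16"
    have e: "0 < e" using \<epsilon> \<kappa> by (simp add: e_def)
    define \<delta> where "\<delta> = (c0 * e / 8) powr (1 / \<eta>)"
    have \<delta>: "0 < \<delta>" "\<delta> powr \<eta> = c0 * e / 8"
      using c0 e \<eta> by (auto simp: \<delta>_def powr_powr)
    define R where "R = 1 - c0 / 4 * \<delta> powr \<theta>"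
    have "R < 1" using \<delta>(1) c0 by (simp add: R_def)
    then have "compact (cball (0::complex) R)" "cball (0::complex) R \<subseteq> ball 0 1" by auto
    from uniform_limitD[OF g(4)[OF this], of "sqrt e"] e
    have "\<forall>\<^sub>F k in sequentially. \<forall>z\<in>cball 0 R. cmod (f (r k) z - g z) < sqrt e"
      by (simp add: dist_norm)
    then obtain N where N: "\<And>k z. k \<ge> N \<Longrightarrow> z \<in> cball 0 R \<Longrightarrow> cmod (f (r k) z - g z) < sqrt e"
      unfolding eventually_sequentially by blast
    have "hardy_norm (D k) < \<epsilon>" "0 \<le> hardy_norm (D k)" if k: "k \<ge> N" for k
    proof -
      have le: "(cmod (D k (of_real \<rho> * cis t)))\<^sup>2 \<le> e * \<bar>sin t\<bar> powr (- \<kappa>)"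
        if \<rho>: "0 < \<rho>" "\<rho> < 1" and t: "sin t \<noteq> 0" for \<rho> t
      proof (cases "\<delta> \<le> \<bar>sin t\<bar>")
        case True
        have "c0 / 4 * \<delta> powr \<theta> \<le> c0 / 4 * \<bar>sin t\<bar> powr \<theta>"
          using True \<delta> c0 \<theta> by (intro mult_left_mono powr_mono2) auto
        then have "lens_map \<theta> (of_real \<rho> * cis t) \<in> cball 0 R"
          using norm_lens_map_polar[OF \<theta> \<rho> t] by (simp add: R_def c0_def)
        from N[OF k this] have "cmod (D k (of_real \<rho> * cis t)) \<le> sqrt e" by (simp add: D_def)
        then have "(cmod (D k (of_real \<rho> * cis t)))\<^sup>2 \<le> (sqrt e)\<^sup>2" by (intro power_mono) auto
        also have "\<dots> = e * 1" using e by simp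
        also have "\<dots> \<le> e * \<bar>sin t\<bar> powr (- \<kappa>)"
        proof (intro mult_left_mono)
          have "\<bar>sin t\<bar> powr 0 \<le> \<bar>sin t\<bar> powr (- \<kappa>)"
            using \<kappa> t by (intro powr_mono') auto
          then show "1 \<le> \<bar>sin t\<bar> powr (- \<kappa>)" using t by simp
        qed (use e in simp)
        finally show ?thesis .
      next
        case False
        have "(cmod (D k (of_real \<rho> * cis t)))\<^sup>2 \<le> 8 / c0 * \<bar>sin t\<bar> powr (- \<theta>)"
          by (rule D_le[OF \<rho> t])
        also have "\<bar>sin t\<bar> powr (- \<theta>) = \<bar>sin t\<bar> powr \<eta> * \<bar>sin t\<bar> powr (- \<kappa>)"
          by (simp add: \<kappa>(3) powr_add[symmetric])
        also have "8 / c0 * (\<bar>sin t\<bar> powr \<eta> * \<bar>sin t\<bar> powr (- \<kappa>)) \<le> 8 / c0 * (\<delta> powr \<eta> * \<bar>sin t\<bar> powr (- \<kappa>))"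
          using False c0 \<eta> by (intro mult_left_mono mult_right_mono powr_mono2) auto
        finally show ?thesis using c0 by (simp add: \<delta>(2))
      qed
      note maj = hardy2_if_sin_majorant[OF \<kappa>(1,2) less_imp_le[OF e] holD le]
      have "(hardy_norm (D k))\<^sup>2 \<le> 8 / (1 - \<kappa>) * e" by (rule maj(2))
      also have "\<dots> = \<epsilon>\<^sup>2 / 2" using \<kappa> by (simp add: e_def)
      also have "\<dots> < \<epsilon>\<^sup>2" using \<epsilon> by simp
      finally show "hardy_norm (D k) < \<epsilon>" 
        by (rule power2_less_imp_less) (use \<epsilon> in simp)
      show "0 \<le> hardy_norm (D k)" by (rule hardy_norm_nonneg[OF maj(1)])
    qed
    then show "\<exists>N. \<forall>k\<ge>N. norm (hardy_norm (D k) - 0) < \<epsilon>"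
      by (intro exI[of _ N]) simp
  qed
  with g(2) G show "\<exists>r g. strict_mono r \<and> g \<in> hardy2 \<and>
      (\<lambda>k. hardy_norm (\<lambda>z. f (r k) (lens_map \<theta> z) - g z)) \<longlonglongrightarrow> 0"
    by (intro exI[of _ r] exI[of _ "\<lambda>z. g (lens_map \<theta> z)"] conjI) (simp_all add: D_def[abs_def])
qed

text \<open>Rank of order m^2 and error q^(m/2) give singular numbers bounded by exp(-c sqrt n) up
  to constants, and every positive power of such a sequence is summable.\<close>

lemma composition_schatten:
  assumes p: "0 < p"
  shows "schatten_class p (\<lambda>f z. f (lens_map \<theta> z))"
  unfolding schatten_class_def
proof (intro conjI composition_compact)
  let ?T = "\<lambda>f z. f (lens_map \<theta> z)"
  obtain K q where K: "0 \<le> K" and q: "0 < q" "q < 1"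
    and s: "\<And>m n. (2 * m + 1) * m \<le> n \<Longrightarrow> singular_number (Suc n) ?T \<le> sqrt (K * q ^ m)"
    using composition_approximation[OF \<theta>] by blast
  define c where "c = - (p / 2) * ln q"
  have c: "0 < c" using p q by (simp add: c_def mult_pos_neg)
  show "summable (\<lambda>n. singular_number (Suc n) ?T powr p)"
  proof (rule summable_comparison_test')
    show "summable (\<lambda>n. K powr (p / 2) * exp (- c * (sqrt (real n / 3) - 1)))"
      by (intro summable_mult summable_exp_minus_sqrt c)
    fix n :: nat
    \<comment> \<open>The largest m with 3 m^2 <= n; the rank (2m+1)m is at most 3 m^2, so the
      approximation applies at this n.\<close>
    define m where "m = nat \<lfloor>sqrt (real n / 3)\<rfloor>"
    have m: "real m \<le> sqrt (real n / 3)" "sqrt (real n / 3) - 1 \<le> real m"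
      unfolding m_def by (auto simp: le_floor_iff)
    have "(real m)\<^sup>2 \<le> real n / 3"
      using power_mono[OF m(1), of 2] by simp
    then have "real (3 * m * m) \<le> real n" by (simp add: power2_eq_square)
    then have "3 * m * m \<le> n" by (simp only: of_nat_le_iff)
    moreover have "(2 * m + 1) * m \<le> 3 * m * m" by (cases m) (auto simp: algebra_simps)
    ultimately have "(2 * m + 1) * m \<le> n" by linarith
    note sn = s[OF this]
    have s0: "0 \<le> singular_number (Suc n) ?T"
      by (rule singular_number_nonneg[OF composition_bounded[OF \<theta>]])
    have "singular_number (Suc n) ?T powr p \<le> sqrt (K * q ^ m) powr p"
      using sn s0 p by (intro powr_mono2) auto
    also have "\<dots> = (K * q powr real m) powr (p / 2)"
      using K q by (simp add: powr_half_sqrt[symmetric] powr_powr powr_realpow)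
    also have "\<dots> = K powr (p / 2) * exp (- c * real m)"
      using K q by (simp add: powr_mult powr_powr c_def) (simp add: powr_def mult_ac)
    also have "\<dots> \<le> K powr (p / 2) * exp (- c * (sqrt (real n / 3) - 1))"
      using m(2) c by (intro mult_left_mono) auto
    finally show "norm (singular_number (Suc n) ?T powr p) \<le> K powr (p / 2) * exp (- c * (sqrt (real n / 3) - 1))"
      by simp
  qed
qed

end

theorem theorem6p1:
  fixes \<theta> :: real
  assumes "0 < \<theta>" and "\<theta> < 1"
  defines "a \<equiv> (1 - 1 / \<theta>) / 2"
  defines "w \<equiv> (\<lambda>z. (1 - lens_map \<theta> z) powr complex_of_real a)"
  shows "w \<in> hardy2
    \<and> bounded_hardy_op (\<lambda>f z. w z * f (lens_map \<theta> z))
    \<and> \<not> compact_hardy_op (\<lambda>f z. w z * f (lens_map \<theta> z))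
    \<and> (\<forall>p>0. schatten_class p (\<lambda>f z. f (lens_map \<theta> z)))"
  unfolding w_def a_def
  by (intro conjI allI impI lens_weight_hardy2 weighted_composition_bounded
      weighted_composition_not_compact composition_schatten assms(1,2))

end
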